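(* For every odd positive integer $n$, there exist a $\mathrm{TOC}_4(7^n+1,5,3)$ and a $\mathrm{TOC}_3(8^n+1,5,3)$.
   Context: $\mathcal{H}_q(n,w)$ is the set of all words of length $n$ over $\mathbb{Z}_q$ with exactly $w$ nonzero entries, with the Hamming distance. An $(n,d,w)_q$-code is a nonempty subset of $\mathcal{H}_q(n,w)$ in which any two distinct words have Hamming distance at least $d$; $A_q(n,d,w)$ is the maximum size of such a code and a code of this size is optimal. A $\mathrm{TOC}_q(n,d,w)$ is a partition of $\mathcal{H}_q(n,w)$ into mutually disjoint optimal $(n,d,w)_q$-codes. *)

theory Defs
  imports Main
begin

text \<open>Words of length n over Z_q are represented as lists of naturals of length n
  with entries in {0..<q}; the symbol 0 is the zero of Z_q.\<close>

definition hamming_dist :: "nat list \<Rightarrow> nat list \<Rightarrow> nat" where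
  "hamming_dist x y = card {i. i < length x \<and> x ! i \<noteq> y ! i}"

definition weight :: "nat list \<Rightarrow> nat" where
  "weight x = card {i. i < length x \<and> x ! i \<noteq> 0}"

definition Hq :: "nat \<Rightarrow> nat \<Rightarrow> nat \<Rightarrow> nat list set" where
  "Hq q n w = {x. length x = n \<and> set x \<subseteq> {0..<q} \<and> weight x = w}"

definition is_code :: "nat \<Rightarrow> nat \<Rightarrow> nat \<Rightarrow> nat \<Rightarrow> nat list set \<Rightarrow> bool" where
  "is_code q n d w C \<longleftrightarrow> C \<noteq> {} \<and> C \<subseteq> Hq q n w \<and>
     (\<forall>x\<in>C. \<forall>y\<in>C. x \<noteq> y \<longrightarrow> d \<le> hamming_dist x y)"

definition Aq :: "nat \<Rightarrow> nat \<Rightarrow> nat \<Rightarrow> nat \<Rightarrow> nat" where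
  "Aq q n d w = Max (card ` {C. is_code q n d w C})"

definition optimal_code :: "nat \<Rightarrow> nat \<Rightarrow> nat \<Rightarrow> nat \<Rightarrow> nat list set \<Rightarrow> bool" where
  "optimal_code q n d w C \<longleftrightarrow> is_code q n d w C \<and> card C = Aq q n d w"

definition is_TOC :: "nat \<Rightarrow> nat \<Rightarrow> nat \<Rightarrow> nat \<Rightarrow> nat list set set \<Rightarrow> bool" where
  "is_TOC q n d w P \<longleftrightarrow> \<Union>P = Hq q n w \<and>
     (\<forall>C\<in>P. optimal_code q n d w C) \<and>
     (\<forall>C\<in>P. \<forall>D\<in>P. C \<noteq> D \<longrightarrow> C \<inter> D = {})"

end

theory Submission
  imports Defs "Berlekamp_Zassenhaus.Finite_Field" "HOL-Algebra.Algebraic_Closure_Type"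
    "HOL-Library.Disjoint_Sets"
begin

text \<open>
  In a code with distance 5 and weight 3 every pair of a position and a nonzero symbol occurs at
  most once, so a code of size \<open>n (q - 1) / 3\<close> is optimal.

  Let \<open>q\<close> be 7 or 8 and \<open>Q = q ^ n\<close>. The images of the projective line over \<open>F\<^sub>q\<close> form a Steiner
  system of blocks of size \<open>q + 1\<close> on the projective line over \<open>F\<^sub>Q\<close>. For \<open>\<tau>\<close> in the quadratic
  extension of \<open>F\<^sub>Q\<close>, outside \<open>F\<^sub>Q\<close>, the map \<open>x \<mapsto> (x - \<tau>) / (x - \<tau> ^ Q)\<close> identifies the line
  with the group of \<open>(Q + 1)\<close>-th roots of unity. As \<open>n\<close> is odd, this group contains the
  \<open>(q + 1)\<close>-th roots of unity, and their cosets pull back to a parallel class of blocks.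
  The conjugates \<open>\<tau>\<close> and \<open>\<tau> ^ Q\<close> give the same class, and every block lies in exactly
  \<open>q (q - 1) / 2\<close> of these classes, that is in 21 or 28 of them. On the 8 or 9 points of a block
  there is a partition into 189 or 112 optimal codes, so each class through the block can be given
  9 or 4 of these codes for itself; uniting them over the blocks of a class gives optimal codes
  of length \<open>Q + 1\<close>.
\<close>

section \<open>Tilings by codes\<close>

lemma finite_Hq: "finite (Hq q n w)"
  by (rule finite_subset[OF _ finite_lists_length_eq[of "{0..<q}" n]]) (auto simp: Hq_def)

text \<open>Two words with the same nonzero symbol at a common position can differ only at the other
  2 + 2 positions of their supports. So the pairs of a position and its symbol, three for each word,
  are all different, and only \<open>n * (q - 1)\<close> such pairs exist.\<close>

lemma card_code_le:
  assumes "is_code q n 5 3 C"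
  shows "3 * card C \<le> n * (q - 1)"
proof -
  define S where "S x = {i. i < n \<and> x ! i \<noteq> 0}" for x :: "nat list"
  have C: "length x = n" "set x \<subseteq> {0..<q}" "card (S x) = 3" if "x \<in> C" for x
    using assms that by (auto simp: is_code_def Hq_def weight_def S_def)
  have fin: "finite C"
    using assms finite_subset[OF _ finite_Hq] by (auto simp: is_code_def)
  have finS: "finite (S x)" for x by (simp add: S_def)
  have "inj_on (\<lambda>(x, i). (i, x ! i)) (Sigma C S)"
  proof -
    have "x = y" if x: "x \<in> C" "i \<in> S x" and y: "y \<in> C" "i \<in> S y" and e: "x ! i = y ! i"
      for x y i
    proof (rule ccontr)
      assume "x \<noteq> y"
      then have "5 \<le> hamming_dist x y"
        using assms x y by (auto simp: is_code_def)
      also have "\<dots> \<le> card ((S x - {i}) \<union> (S y - {i}))"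
        unfolding hamming_dist_def using C(1)[OF x(1)] e finS
        by (intro card_mono) (auto simp: S_def)
      also have "\<dots> \<le> card (S x - {i}) + card (S y - {i})"
        by (rule card_Un_le)
      also have "\<dots> = 4"
        using x y C(3) finS by simp
      finally show False by simp
    qed
    then show ?thesis by (auto simp: inj_on_def)
  qed
  then have "card (Sigma C S) = card ((\<lambda>(x, i). (i, x ! i)) ` Sigma C S)"
    by (simp add: card_image)
  also have "\<dots> \<le> card ({..<n} \<times> {1..<q})"
    using C(1,2) by (intro card_mono) (auto simp: S_def Suc_le_eq subset_iff dest!: nth_mem)
  finally show ?thesis
    using fin finS C(3) by (simp add: card_SigmaI)
qed

lemma optimal_codeI:
  assumes "is_code q n 5 3 C" "3 * card C = n * (q - 1)"
  shows "optimal_code q n 5 3 C"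
proof -
  have "card C = Max (card ` {C. is_code q n 5 3 C})"
  proof (rule Max_eqI[symmetric])
    have "{C. is_code q n 5 3 C} \<subseteq> Pow (Hq q n 3)"
      by (auto simp: is_code_def)
    then show "finite (card ` {C. is_code q n 5 3 C})"
      by (intro finite_imageI) (rule finite_subset, auto simp: finite_Hq)
  next
    fix m assume "m \<in> card ` {C. is_code q n 5 3 C}"
    then obtain D where "is_code q n 5 3 D" "m = card D" by auto
    with card_code_le[of q n D] assms(2) show "m \<le> card C" by simp
  qed (use assms in auto)
  then show ?thesis
    using assms by (simp add: optimal_code_def Aq_def)
qed

section \<open>Tilings and their transport along isometries\<close>

text \<open>Words and distance are left abstract so that tilings can move between lists and
  functions on a point set. In use \<open>m\<close> is the length times \<open>q - 1\<close>, so the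
  size condition gives optimality; \<open>partition_on\<close> keeps the codes nonempty.\<close>

definition tiling :: "('w \<Rightarrow> 'w \<Rightarrow> nat) \<Rightarrow> 'w set \<Rightarrow> nat \<Rightarrow> 'w set set \<Rightarrow> bool" where
  "tiling d H m P \<longleftrightarrow> partition_on H P \<and>
     (\<forall>C\<in>P. 3 * card C = m \<and> (\<forall>x\<in>C. \<forall>y\<in>C. x \<noteq> y \<longrightarrow> 5 \<le> d x y))"

lemma tiling_imp_TOC:
  assumes "tiling hamming_dist (Hq q n 3) (n * (q - 1)) P"
  shows "is_TOC q n 5 3 P"
proof -
  have part: "partition_on (Hq q n 3) P" and card: "\<And>C. C \<in> P \<Longrightarrow> 3 * card C = n * (q - 1)"
    and code: "\<And>C. C \<in> P \<Longrightarrow> is_code q n 5 3 C"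
    using assms unfolding tiling_def is_code_def partition_on_def by blast+
  show ?thesis
    unfolding is_TOC_def using part optimal_codeI[OF code card]
    by (auto simp: partition_on_def dest: disjointD)
qed

lemma tiling_image:
  assumes f: "bij_betw f H H'"
    and d: "\<And>x y. x \<in> H \<Longrightarrow> y \<in> H \<Longrightarrow> d' (f x) (f y) = d x y"
    and P: "tiling d H m P"
  shows "tiling d' H' m ((`) f ` P)" "card ((`) f ` P) = card P"
proof -
  have inj: "inj_on f H" and H': "f ` H = H'"
    using f by (auto simp: bij_betw_def)
  have part: "partition_on H P"
    using P by (simp add: tiling_def)
  have sub: "C \<subseteq> H" if "C \<in> P" for C
    using part that by (auto simp: partition_on_def)
  show "card ((`) f ` P) = card P"
    using sub inj by (intro card_image inj_onI) (meson inj_on_image_eq_iff)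
  have "partition_on H' ((`) f ` P)"
  proof (rule partition_onI)
    show "\<Union> ((`) f ` P) = H'"
      using part H' by (auto simp: partition_on_def)
    show "disjnt A B" if "A \<in> (`) f ` P" "B \<in> (`) f ` P" "A \<noteq> B" for A B
    proof -
      from that obtain C D where "C \<in> P" "D \<in> P" "A = f ` C" "B = f ` D" by auto
      moreover from this that have "C \<inter> D = {}"
        using part by (auto simp: partition_on_def dest: disjointD)
      ultimately show ?thesis
        using sub inj_on_image_Int[OF inj, of C D] by (auto simp: disjnt_def)
    qed
    show "{} \<notin> (`) f ` P"
      using part by (auto simp: partition_on_def)
  qed
  moreover have "3 * card (f ` C) = m" if "C \<in> P" for C
    using P that sub card_image[OF inj_on_subset[OF inj sub[OF that]]] by (simp add: tiling_def)
  moreover have "5 \<le> d' (f x) (f y)" if "C \<in> P" "x \<in> C" "y \<in> C" "f x \<noteq> f y" for C x y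
  proof -
    have "x \<noteq> y" "x \<in> H" "y \<in> H" using that sub by auto
    then show ?thesis using P that d by (simp add: tiling_def)
  qed
  ultimately show "tiling d' H' m ((`) f ` P)"
    by (auto simp: tiling_def)
qed

text \<open>Functions on the whole type, zero off \<open>V\<close>, let words on different blocks
  live in one type, where extension by zero is the identity. Three as the size of the support also
  makes it finite, since infinite sets have \<open>card\<close> 0.\<close>

definition fwords :: "nat \<Rightarrow> 'a set \<Rightarrow> ('a \<Rightarrow> nat) set" where
  "fwords q V = {f. (\<forall>x. f x < q) \<and> {x. f x \<noteq> 0} \<subseteq> V \<and> card {x. f x \<noteq> 0} = 3}"

definition fdist :: "('a \<Rightarrow> nat) \<Rightarrow> ('a \<Rightarrow> nat) \<Rightarrow> nat" where
  "fdist f g = card {x. f x \<noteq> g x}"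

text \<open>A numbering \<open>h\<close> of the points translates: \<open>F\<close> reads the list
  at the number of a point, and its inverse \<open>G\<close> tabulates a function along
  \<open>h\<close>.\<close>

lemma fwords_isometry:
  assumes h: "bij_betw h {..<v} V" and q: "0 < q"
  obtains F where "bij_betw F (Hq q v 3) (fwords q V)"
    "\<And>x y. x \<in> Hq q v 3 \<Longrightarrow> y \<in> Hq q v 3 \<Longrightarrow> fdist (F x) (F y) = hamming_dist x y"
proof -
  define g where "g = the_inv_into {..<v} h"
  have gh: "g (h i) = i" if "i < v" for i
    using h that by (simp add: g_def bij_betw_def the_inv_into_f_f)
  have hg: "h (g p) = p" "g p < v" if "p \<in> V" for p
    using h that f_the_inv_into_f_bij_betw[OF h] the_inv_into_into[of h "{..<v}" p "{..<v}"]
    by (auto simp: g_def bij_betw_def)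
  have hX: "h i \<in> V" if "i < v" for i
    using h that by (auto simp: bij_betw_def)
  have himg: "p \<in> h ` A" if "p \<in> V" "g p \<in> A" for p A
    using hg(1)[OF that(1)] that(2) by (metis imageI)
  have inj: "inj_on h A" if "A \<subseteq> {..<v}" for A
    using h that inj_on_subset by (auto simp: bij_betw_def)
  define F where "F x = (\<lambda>p. if p \<in> V then x ! g p else 0)" for x :: "nat list"
  define G where "G f = map (\<lambda>i. f (h i)) [0..<v]" for f :: "'a \<Rightarrow> nat"
  have supp: "{p. F x p \<noteq> 0} = h ` {i. i < length x \<and> x ! i \<noteq> 0}" if "length x = v" for x
    unfolding that by (auto simp: F_def hX gh hg intro!: himg)
  have dist: "{p. F x p \<noteq> F y p} = h ` {i. i < length x \<and> x ! i \<noteq> y ! i}" if "length x = v" for x y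
    unfolding that by (auto simp: F_def hX gh hg intro!: himg)
  have "bij_betw F (Hq q v 3) (fwords q V)"
  proof (rule bij_betwI[where g = G])
    show "F \<in> Hq q v 3 \<rightarrow> fwords q V"
    proof
      fix x assume x: "x \<in> Hq q v 3"
      then have len: "length x = v" and w: "card {i. i < v \<and> x ! i \<noteq> 0} = 3"
        by (auto simp: Hq_def weight_def)
      have "F x p < q" for p
        using x q hg(2)[of p] nth_mem[of "g p" x] by (auto simp: F_def Hq_def subset_iff)
      moreover have "card {p. F x p \<noteq> 0} = 3"
        unfolding supp[OF len] len using w by (subst card_image) (auto intro!: inj)
      moreover have "{p. F x p \<noteq> 0} \<subseteq> V"
        by (auto simp: F_def split: if_splits)
      ultimately show "F x \<in> fwords q V"
        by (simp add: fwords_def)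
    qed
    show "G \<in> fwords q V \<rightarrow> Hq q v 3"
    proof
      fix f assume f: "f \<in> fwords q V"
      have "{p. f p \<noteq> 0} = h ` {i. i < v \<and> f (h i) \<noteq> 0}"
        using f by (auto simp: fwords_def hg subset_iff intro!: himg)
      then have "card {i. i < v \<and> f (h i) \<noteq> 0} = 3"
        using f card_image[OF inj[of "{i. i < v \<and> f (h i) \<noteq> 0}"]] by (auto simp: fwords_def)
      moreover have "{i. i < v \<and> G f ! i \<noteq> 0} = {i. i < v \<and> f (h i) \<noteq> 0}"
        by (auto simp: G_def)
      ultimately show "G f \<in> Hq q v 3"
        using f by (auto simp: Hq_def weight_def fwords_def G_def)
    qed
    show "G (F x) = x" if "x \<in> Hq q v 3" for x
      using that by (intro nth_equalityI) (auto simp: Hq_def G_def F_def hX gh)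
    show "F (G f) = f" if "f \<in> fwords q V" for f
      using that by (intro ext) (auto simp: F_def G_def fwords_def hg subset_iff)
  qed
  moreover have "fdist (F x) (F y) = hamming_dist x y" if "x \<in> Hq q v 3" "y \<in> Hq q v 3" for x y
  proof -
    have "length x = v" using that by (simp add: Hq_def)
    then show ?thesis
      unfolding fdist_def hamming_dist_def
      by (subst dist) (auto intro!: card_image inj)
  qed
  ultimately show ?thesis using that by blast
qed

lemma tiling_Hq_of_fwords:
  assumes P: "tiling fdist (fwords q V) m P" and V: "finite V" "0 < q"
  shows "\<exists>P'. tiling hamming_dist (Hq q (card V) 3) m P' \<and> card P' = card P"
proof -
  obtain h where h: "bij_betw h {..<card V} V"
    using V ex_bij_betw_nat_finite[of V] by (auto simp: atLeast0LessThan)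
  obtain F where F: "bij_betw F (Hq q (card V) 3) (fwords q V)"
      "\<And>x y. x \<in> Hq q (card V) 3 \<Longrightarrow> y \<in> Hq q (card V) 3 \<Longrightarrow> fdist (F x) (F y) = hamming_dist x y"
    using fwords_isometry[OF h V(2)] by blast
  let ?G = "the_inv_into (Hq q (card V) 3) F"
  have G: "bij_betw ?G (fwords q V) (Hq q (card V) 3)"
    by (rule bij_betw_the_inv_into[OF F(1)])
  have "hamming_dist (?G f) (?G g) = fdist f g" if "f \<in> fwords q V" "g \<in> fwords q V" for f g
    using F(2)[of "?G f" "?G g"] that f_the_inv_into_f_bij_betw[OF F(1)] bij_betwE[OF G] by simp
  from tiling_image[where d = fdist and d' = hamming_dist, OF G this P] show ?thesis by blast
qed

section \<open>Gluing codes along parallel classes\<close>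

lemma fwords_mono: "V \<subseteq> Y \<Longrightarrow> fwords q V \<subseteq> fwords q Y"
  by (auto simp: fwords_def)

lemma fdist_disjoint_supports:
  assumes "f \<in> fwords q V" "g \<in> fwords q Y" "V \<inter> Y = {}"
  shows "fdist f g = 6"
proof -
  have fin: "finite {x. f x \<noteq> 0}" "finite {x. g x \<noteq> 0}"
    using assms by (auto simp: fwords_def intro: card_ge_0_finite)
  have "{x. f x \<noteq> g x} = {x. f x \<noteq> 0} \<union> {x. g x \<noteq> 0}"
    using assms by (auto simp: fwords_def subset_iff) (metis disjoint_iff)+
  moreover have "{x. f x \<noteq> 0} \<inter> {x. g x \<noteq> 0} = {}"
    using assms by (auto simp: fwords_def)
  ultimately show ?thesis
    using fin assms by (simp add: fdist_def card_Un_disjoint fwords_def)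
qed

text \<open>The codes of each block are distributed evenly over the \<open>l\<close> parallel classes
  containing it; that the blocks are covered \<open>l\<close> times therefore does no harm.\<close>

lemma tiling_of_resolution:
  fixes V :: "'a set" and cls :: "'i \<Rightarrow> 'a set set"
  assumes V: "finite V"
    and I: "finite I"
    and part: "\<And>i. i \<in> I \<Longrightarrow> partition_on V (cls i)"
    and size: "\<And>i B. i \<in> I \<Longrightarrow> B \<in> cls i \<Longrightarrow> card B = k"
    and uniq: "\<And>i j B D. i \<in> I \<Longrightarrow> j \<in> I \<Longrightarrow> B \<in> cls i \<Longrightarrow> D \<in> cls j \<Longrightarrow>
                 3 \<le> card (B \<inter> D) \<Longrightarrow> B = D"
    and cover: "\<And>T. T \<subseteq> V \<Longrightarrow> card T = 3 \<Longrightarrow> \<exists>i\<in>I. \<exists>B\<in>cls i. T \<subseteq> B"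
    and mult: "\<And>i B. i \<in> I \<Longrightarrow> B \<in> cls i \<Longrightarrow> card {j\<in>I. B \<in> cls j} = l"
    and base: "tiling hamming_dist (Hq q k 3) (k * (q - 1)) P" "card P = l * m"
    and q: "1 < q" and k: "0 < k" and ne: "V \<noteq> {}"
  shows "\<exists>P. tiling fdist (fwords q V) (card V * (q - 1)) P"
proof -
  let ?Bs = "\<Union>i\<in>I. cls i"
  have fin: "finite B" and BX: "B \<subseteq> V" if "B \<in> ?Bs" for B
    using that part V by (auto simp: partition_on_def intro: finite_subset)
  \<comment> \<open>Each block receives a copy of the base tiling on its own points.\<close>
  have "\<exists>P'. tiling fdist (fwords q B) (k * (q - 1)) P' \<and> card P' = l * m \<and> finite P'"
    if B: "B \<in> ?Bs" for B
  proof -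
    have "card B = k" using B size by auto
    then obtain h where h: "bij_betw h {..<k} B"
      using ex_bij_betw_nat_finite[OF fin[OF B]] by (auto simp: atLeast0LessThan)
    obtain F where F: "bij_betw F (Hq q k 3) (fwords q B)"
      "\<And>x y. x \<in> Hq q k 3 \<Longrightarrow> y \<in> Hq q k 3 \<Longrightarrow> fdist (F x) (F y) = hamming_dist x y"
      using fwords_isometry[OF h, of q] q by auto
    have "finite P"
      using base(1) finite_elements[OF finite_Hq] by (auto simp: tiling_def)
    then show ?thesis
      using tiling_image[where d = hamming_dist and d' = fdist, OF F base(1)] base by (intro exI[of _ "(`) F ` P"]) auto
  qed
  then obtain PB where PB: "\<And>B. B \<in> ?Bs \<Longrightarrow> tiling fdist (fwords q B) (k * (q - 1)) (PB B)"
     "\<And>B. B \<in> ?Bs \<Longrightarrow> card (PB B) = l * m" "\<And>B. B \<in> ?Bs \<Longrightarrow> finite (PB B)"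
    by metis
  \<comment> \<open>The \<open>l * m\<close> codes on a block are labelled by the \<open>l\<close>
    classes through it together with a number below \<open>m\<close>.\<close>
  have "\<exists>e. bij_betw e ({j\<in>I. B \<in> cls j} \<times> {..<m}) (PB B)" if "B \<in> ?Bs" for B
    using that PB(2,3)[OF that] mult I by (intro finite_same_card_bij) auto
  then obtain e where e: "\<And>B. B \<in> ?Bs \<Longrightarrow> bij_betw (e B) ({j\<in>I. B \<in> cls j} \<times> {..<m}) (PB B)"
    by metis
  define code where "code = (\<lambda>(i, j). \<Union>B\<in>cls i. e B (i, j))"
  have ePB: "e B (i, j) \<in> PB B" if "i \<in> I" "B \<in> cls i" "j < m" for B i j
    using e[of B] that by (auto simp: bij_betw_def)
  have PBi: "tiling fdist (fwords q B) (k * (q - 1)) (PB B)" if "i \<in> I" "B \<in> cls i" for i B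
    using PB(1) that by blast
  have efw: "e B (i, j) \<subseteq> fwords q B" if "i \<in> I" "B \<in> cls i" "j < m" for B i j
    using PBi[OF that(1,2)] ePB[OF that] by (auto simp: tiling_def partition_on_def)
  have disj: "B \<inter> D = {}" if "i \<in> I" "B \<in> cls i" "D \<in> cls i" "B \<noteq> D" for i B D
    using part[OF that(1)] that by (auto simp: partition_on_def dest: disjointD)
  \<comment> \<open>The support of a common word consists of three points in both blocks, so
    \<open>uniq\<close> applies.\<close>
  have same_block: "B = D" if "f \<in> fwords q B" "f \<in> fwords q D" "B \<in> ?Bs" "D \<in> ?Bs" for f B D
  proof -
    have "card {x. f x \<noteq> 0} \<le> card (B \<inter> D)"
      using that fin by (intro card_mono) (auto simp: fwords_def)
    then have "3 \<le> card (B \<inter> D)"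
      using that by (simp add: fwords_def)
    then show ?thesis
      using that uniq by auto
  qed
  have fcls: "finite (cls i)" if "i \<in> I" for i
    using part[OF that] V by (rule finite_elements[rotated])
  have code_ne: "code (i, j) \<noteq> {}" and code_card: "3 * card (code (i, j)) = card V * (q - 1)"
    and code_far: "\<And>f g. f \<in> code (i, j) \<Longrightarrow> g \<in> code (i, j) \<Longrightarrow> f \<noteq> g \<Longrightarrow> 5 \<le> fdist f g"
    and code_sub: "code (i, j) \<subseteq> fwords q V"
    if ij: "i \<in> I" "j < m" for i j
  proof -
    have c3: "3 * card (e B (i, j)) = k * (q - 1)" if "B \<in> cls i" for B
      using PBi[OF ij(1) that] ePB[OF ij(1) that ij(2)] by (auto simp: tiling_def)
    have finE: "finite (e B (i, j))" if "B \<in> cls i" for B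
      using c3[OF that] q k by (intro card_ge_0_finite) (auto intro: ccontr)
    have dE: "e B (i, j) \<inter> e D (i, j) = {}" if "B \<in> cls i" "D \<in> cls i" "B \<noteq> D" for B D
      using efw[OF ij(1) _ ij(2)] that same_block ij by blast
    have "card (code (i, j)) = (\<Sum>B\<in>cls i. card (e B (i, j)))"
      unfolding code_def using fcls[OF ij(1)] finE dE by (simp add: card_UN_disjoint)
    then have "3 * card (code (i, j)) = (\<Sum>B\<in>cls i. card B * (q - 1))"
      using c3 size ij by (simp add: sum_distrib_left)
    also have "\<dots> = (\<Sum>B\<in>cls i. card B) * (q - 1)"
      by (simp add: sum_distrib_right)
    \<comment> \<open>The blocks of a class partition \<open>V\<close>, so the local sizes add up to
      the required size on \<open>V\<close>.\<close>
    also have "(\<Sum>B\<in>cls i. card B) = card V"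
      using part[OF ij(1)] fin ij by (metis UN_I product_partition)
    finally show c: "3 * card (code (i, j)) = card V * (q - 1)" .
    then show "code (i, j) \<noteq> {}"
      using ne V q by (auto simp: card_gt_0_iff)
    show "code (i, j) \<subseteq> fwords q V"
      unfolding code_def using efw[OF ij(1) _ ij(2)] fwords_mono BX ij by fastforce
    show "5 \<le> fdist f g" if fg: "f \<in> code (i, j)" "g \<in> code (i, j)" "f \<noteq> g" for f g
    proof -
      from fg obtain B D where BD: "B \<in> cls i" "D \<in> cls i" "f \<in> e B (i, j)" "g \<in> e D (i, j)"
        by (auto simp: code_def)
      show ?thesis
      proof (cases "B = D")
        case True
        then show ?thesis
          using PBi[OF ij(1) BD(1)] ePB[OF ij(1) BD(1) ij(2)] BD fg(3) by (auto simp: tiling_def)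
      next
        case False
        then have "fdist f g = 6"
          using fdist_disjoint_supports efw[OF ij(1) _ ij(2)] BD disj[OF ij(1)] by (meson subsetD)
        then show ?thesis by simp
      qed
    qed
  qed
  have "partition_on (fwords q V) (code ` (I \<times> {..<m}))"
  proof (rule partition_onI)
    show "{} \<notin> code ` (I \<times> {..<m})"
      using code_ne by auto
    show "\<Union> (code ` (I \<times> {..<m})) = fwords q V"
    proof
      show "fwords q V \<subseteq> \<Union> (code ` (I \<times> {..<m}))"
      proof
        fix f assume f: "f \<in> fwords q V"
        then obtain i B where iB: "i \<in> I" "B \<in> cls i" "{x. f x \<noteq> 0} \<subseteq> B"
          using cover[of "{x. f x \<noteq> 0}"] by (auto simp: fwords_def)
        then have "f \<in> fwords q B"
          using f by (simp add: fwords_def)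
        then obtain C where C: "C \<in> PB B" "f \<in> C"
          using PBi[OF iB(1,2)] unfolding tiling_def partition_on_def by blast
        \<comment> \<open>The class \<open>i'\<close> in the label of \<open>C\<close> may differ
          from \<open>i\<close>, but it contains \<open>B\<close> as well, which suffices.\<close>
        then obtain i' j where "i' \<in> I" "B \<in> cls i'" "j < m" "C = e B (i', j)"
          using e[of B] iB by (auto simp: bij_betw_def image_iff)
        then have "f \<in> code (i', j)" "(i', j) \<in> I \<times> {..<m}"
          using C by (auto simp: code_def)
        then show "f \<in> \<Union> (code ` (I \<times> {..<m}))" by blast
      qed
    qed (use code_sub in auto)
    show "disjnt A A'" if "A \<in> code ` (I \<times> {..<m})" "A' \<in> code ` (I \<times> {..<m})" "A \<noteq> A'" for A A'
    proof -
      from that obtain i j i' j' where ij: "i \<in> I" "j < m" "A = code (i, j)"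
        and ij': "i' \<in> I" "j' < m" "A' = code (i', j')" by auto
      have False if f: "f \<in> A" "f \<in> A'" for f
      proof -
        obtain B where B: "B \<in> cls i" "f \<in> e B (i, j)"
          using f ij by (auto simp: code_def)
        obtain D where D: "D \<in> cls i'" "f \<in> e D (i', j')"
          using f ij' by (auto simp: code_def)
        have "B = D"
          using same_block efw[OF ij(1) B(1) ij(2)] efw[OF ij'(1) D(1) ij'(2)] B D ij ij' by blast
        moreover have "disjoint (PB B)"
          using PBi[OF ij(1) B(1)] by (simp add: tiling_def partition_on_def)
        ultimately have "e B (i, j) = e B (i', j')"
          using ePB[OF ij(1) B(1) ij(2)] ePB[OF ij'(1) D(1) ij'(2)] B D
          by (metis IntI disjointD empty_iff)
        then have "(i, j) = (i', j')"
          using e[of B] B D \<open>B = D\<close> ij ij'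
          by (intro inj_onD[of "e B" "{j\<in>I. B \<in> cls j} \<times> {..<m}"]) (auto simp: bij_betw_def)
        then show False
          using \<open>A \<noteq> A'\<close> ij ij' by simp
      qed
      then show ?thesis by (auto simp: disjnt_def)
    qed
  qed
  then show ?thesis
    using code_card code_far by (intro exI[of _ "code ` (I \<times> {..<m})"]) (auto simp: tiling_def)
qed

section \<open>The partitions for lengths 8 and 9\<close>

text \<open>
  An entry \<open>(p, c, s)\<close> of a block is a point \<open>p\<close> with a colour \<open>c < 4\<close> and a shift \<open>s\<close>. Every
  \<open>t :: nat \<Rightarrow> nat\<close> with \<open>t 0 + t 1 + t 2 + t 3\<close> divisible by \<open>m = q - 1\<close> turns the block into the word
  with symbol \<open>1 + (t c + s) mod m\<close> at \<open>p\<close>. The colours in a block are distinct and any three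
  values of \<open>t\<close> determine the fourth, so each word supported by the block arises from exactly
  one \<open>t\<close>. Within a configuration the blocks through a point have different shifts there; hence
  its words for a fixed \<open>t\<close> form a code. The configurations below, found by computer, have
  the property that their seven rotations (fixing the points from 7 on) contain every triple of
  points exactly once; the first one is the Moebius-Kantor configuration.
\<close>

type_synonym block = "(nat \<times> nat \<times> nat) list"

definition config8 :: "block list list" where
  "config8 =
    [[[(0, 0, 0), (1, 1, 0), (2, 2, 0)], [(2, 2, 1), (3, 0, 0), (5, 3, 0)],
     [(1, 1, 1), (4, 2, 0), (5, 3, 1)], [(0, 0, 1), (4, 2, 1), (6, 3, 0)],
     [(3, 0, 1), (4, 2, 2), (7, 1, 0)], [(1, 1, 2), (3, 0, 2), (6, 3, 1)],
     [(0, 0, 2), (5, 3, 2), (7, 1, 1)], [(2, 2, 2), (6, 3, 2), (7, 1, 2)]]]"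

definition config9 :: "block list list" where
  "config9 =
    [[[(0, 0, 0), (1, 1, 0), (2, 2, 0)], [(2, 2, 1), (3, 1, 0), (5, 0, 0)],
      [(0, 0, 1), (3, 1, 1), (4, 2, 0)], [(5, 0, 1), (6, 1, 0), (7, 2, 0)],
      [(4, 2, 1), (6, 1, 1), (8, 0, 0)], [(1, 1, 1), (7, 2, 1), (8, 0, 1)]],
     [[(0, 0, 0), (1, 1, 0), (5, 2, 0)], [(1, 1, 1), (2, 0, 0), (8, 2, 0)],
      [(2, 0, 1), (4, 2, 0), (6, 1, 0)], [(3, 0, 0), (5, 2, 1), (7, 1, 0)],
      [(0, 0, 1), (4, 2, 1), (7, 1, 1)], [(3, 0, 1), (6, 1, 1), (8, 2, 1)]]]"

definition rotations :: "block list list \<Rightarrow> block list list" where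
  "rotations cfgs = concat (map (\<lambda>j. map (map (map
     (\<lambda>(p, c, s). (if p < 7 then (p + j) mod 7 else p, c, s)))) cfgs) [0..<7])"

definition ok_block :: "nat \<Rightarrow> nat \<Rightarrow> block \<Rightarrow> bool" where
  "ok_block v m b \<longleftrightarrow> length b = 3 \<and> distinct (map fst b) \<and> distinct (map (fst \<circ> snd) b) \<and>
     list_all (\<lambda>(p, c, s). p < v \<and> c < 4 \<and> s < m) b"

text \<open>At a common point both blocks use the same value \<open>t c\<close>, so different shifts
  below \<open>m\<close> yield different symbols for every \<open>t\<close>.\<close>

definition ok_pair :: "block \<Rightarrow> block \<Rightarrow> bool" where
  "ok_pair b b' \<longleftrightarrow> length (filter (\<lambda>p. p \<in> set (map fst b')) (map fst b)) \<le> 1 \<and>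
     list_all (\<lambda>(p, c, s). list_all (\<lambda>(p', c', s'). p = p' \<longrightarrow> c = c' \<and> s \<noteq> s') b') b"

text \<open>The equation makes one word per block as many words as the size bound allows,
  \<open>m\<close> being the number of nonzero symbols.\<close>

definition ok_config :: "nat \<Rightarrow> nat \<Rightarrow> block list \<Rightarrow> bool" where
  "ok_config v m cfg \<longleftrightarrow> 3 * length cfg = v * m \<and> list_all (ok_block v m) cfg \<and>
     list_all (\<lambda>b. list_all (\<lambda>b'. b = b' \<or> ok_pair b b') cfg) cfg"

text \<open>Only the presence of each triple is tested; that none occurs twice will follow from the
  number of blocks.\<close>

definition covers_triples :: "nat \<Rightarrow> block list \<Rightarrow> bool" where
  "covers_triples v bs \<longleftrightarrow> (let ts = map (\<lambda>b. sort (map fst b)) bs in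
     list_all (\<lambda>z. list_all (\<lambda>y. list_all (\<lambda>x. [x, y, z] \<in> set ts) [0..<y]) [0..<z]) [0..<v])"

section \<open>Quadruples with sum zero modulo \<open>m\<close>\<close>

text \<open>The fourth value has to be the residue of minus the sum of the other three. The value 0
  from index 4 on makes \<open>t\<close> unique as a function.\<close>

lemma zero_sum_unique:
  fixes m :: nat
  defines "Z \<equiv> {t :: nat \<Rightarrow> nat. (\<forall>c. t c < m) \<and> (\<forall>c\<ge>4. t c = 0) \<and> m dvd (\<Sum>c<4. t c)}"
  assumes c: "distinct [c1, c2, c3]" "c1 < 4" "c2 < 4" "c3 < 4"
    and r: "r1 < m" "r2 < m" "r3 < m"
  shows "\<exists>!t. t \<in> Z \<and> t c1 = r1 \<and> t c2 = r2 \<and> t c3 = r3"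
proof -
  have "card ({..<4} - {c1, c2, c3}) = 1"
    using c by (subst card_Diff_subset) auto
  then obtain c4 where c4: "{..<4} - {c1, c2, c3} = {c4}"
    by (meson card_1_singletonE)
  then have c4': "c4 < 4" "c4 \<noteq> c1" "c4 \<noteq> c2" "c4 \<noteq> c3"
    by auto
  have four: "{..<4} = {c1, c2, c3, c4}"
    using c4 c by auto
  have sum4: "(\<Sum>c<4. t c) = t c1 + t c2 + t c3 + t c4" for t :: "nat \<Rightarrow> nat"
    unfolding four using c c4' by auto
  define R where "R = r1 + r2 + r3"
  \<comment> \<open>This is the residue of \<open>- R\<close>; the outer \<open>mod\<close> takes
    care of the case that \<open>m\<close> divides \<open>R\<close>.\<close>
  define r4 where "r4 = (m - R mod m) mod m"
  have m: "0 < m" using r by simp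
  have "(R + (m - R mod m)) mod m = (R mod m + (m - R mod m)) mod m"
    by (simp add: mod_simps)
  also have "\<dots> = 0"
    using mod_less_divisor[OF m, of R] by simp
  finally have R: "m dvd R + r4"
    unfolding r4_def by (simp only: dvd_eq_mod_eq_0 mod_add_right_eq)
  show ?thesis
  proof (rule ex1I)
    let ?t = "(\<lambda>_. 0)(c1 := r1, c2 := r2, c3 := r3, c4 := r4)"
    show "?t \<in> Z \<and> ?t c1 = r1 \<and> ?t c2 = r2 \<and> ?t c3 = r3"
      using c c4' r m R by (auto simp: Z_def sum4 R_def r4_def)
  next
    fix t assume t: "t \<in> Z \<and> t c1 = r1 \<and> t c2 = r2 \<and> t c3 = r3"
    then have "m dvd R + t c4" "t c4 < m"
      by (auto simp: Z_def sum4 R_def)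
    moreover have "r4 < m" using m by (simp add: r4_def)
    \<comment> \<open>Both truncated differences are multiples of \<open>m\<close> below
      \<open>m\<close>, hence both are 0.\<close>
    moreover have "m dvd t c4 - r4" "m dvd r4 - t c4"
      using dvd_diff_nat[OF \<open>m dvd R + t c4\<close> R] dvd_diff_nat[OF R \<open>m dvd R + t c4\<close>] by simp_all
    ultimately have t4: "t c4 = r4"
      by (metis diff_is_0_eq dvd_imp_le eq_iff leD less_imp_diff_less not_gr_zero)
    show "t = (\<lambda>_. 0)(c1 := r1, c2 := r2, c3 := r3, c4 := r4)"
    proof
      fix c
      show "t c = ((\<lambda>_. 0)(c1 := r1, c2 := r2, c3 := r3, c4 := r4)) c"
      proof (cases "c < 4")
        case True
        then have "c \<in> {c1, c2, c3, c4}" using four by blast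
        then show ?thesis using t t4 by auto
      next
        case False
        then show ?thesis using t t4 c c4' by (auto simp: Z_def)
      qed
    qed
  qed
qed

text \<open>The values at 1, 2 and 3 can be chosen freely and determine the value at 0.\<close>

lemma card_zero_sum:
  fixes m :: nat
  assumes "0 < m"
  shows "card {t :: nat \<Rightarrow> nat. (\<forall>c. t c < m) \<and> (\<forall>c\<ge>4. t c = 0) \<and> m dvd (\<Sum>c<4. t c)} = m ^ 3"
    (is "card ?Z = _")
proof -
  have u: "\<exists>!t. t \<in> ?Z \<and> t 1 = r1 \<and> t 2 = r2 \<and> t 3 = r3" if "r1 < m" "r2 < m" "r3 < m" for r1 r2 r3
    using zero_sum_unique[of 1 2 3 r1 m r2 r3] that by simp
  have "bij_betw (\<lambda>t. (t 1, t 2, t 3)) ?Z ({..<m} \<times> {..<m} \<times> {..<m})"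
  proof (rule bij_betwI')
    show "((x 1, x 2, x 3) = (y 1, y 2, y 3)) = (x = y)" if "x \<in> ?Z" "y \<in> ?Z" for x y
      using u[of "x 1" "x 2" "x 3"] that by auto
    show "\<exists>x\<in>?Z. y = (x 1, x 2, x 3)" if y: "y \<in> {..<m} \<times> {..<m} \<times> {..<m}" for y
    proof -
      obtain r1 r2 r3 where y: "y = (r1, r2, r3)" "r1 < m" "r2 < m" "r3 < m"
        using y by auto
      then obtain t where "t \<in> ?Z" "t 1 = r1" "t 2 = r2" "t 3 = r3"
        using u[of r1 r2 r3] by blast
      then show ?thesis using y(1) by blast
    qed
  qed auto
  then show ?thesis
    by (simp add: bij_betw_same_card power3_eq_cube)
qed

text \<open>Subtraction of \<open>s\<close> modulo \<open>m\<close>, kept within the naturals; it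
  recovers \<open>t c\<close> from a symbol.\<close>

lemma mod_shift_iff:
  fixes m :: nat
  assumes "x < m" "s < m" "a < m"
  shows "(x + s) mod m = a \<longleftrightarrow> x = (a + (m - s)) mod m"
  using assms by (auto simp: mod_if)

section \<open>The codes of a configuration\<close>

definition word_of :: "nat \<Rightarrow> block \<Rightarrow> (nat \<Rightarrow> nat) \<Rightarrow> nat \<Rightarrow> nat" where
  "word_of m b t p = (case map_of b p of None \<Rightarrow> 0 | Some (c, s) \<Rightarrow> Suc ((t c + s) mod m))"

lemma word_of_support: "{p. word_of m b t p \<noteq> 0} = set (map fst b)"
  by (auto simp: word_of_def map_of_eq_None_iff split: option.splits) 

text \<open>Every point of the union of the supports is a point of difference, and the union has at
  least 3 + 3 - 1 points.\<close>

lemma fdist_ge_5: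
  assumes "f \<in> fwords q V" "g \<in> fwords q Y" "card ({x. f x \<noteq> 0} \<inter> {x. g x \<noteq> 0}) \<le> 1"
    "\<And>x. f x \<noteq> 0 \<Longrightarrow> g x \<noteq> 0 \<Longrightarrow> f x \<noteq> g x"
  shows "5 \<le> fdist f g"
proof -
  have fin: "finite {x. f x \<noteq> 0}" "finite {x. g x \<noteq> 0}"
    using assms by (auto simp: fwords_def intro: card_ge_0_finite)
  have "{x. f x \<noteq> g x} = {x. f x \<noteq> 0} \<union> {x. g x \<noteq> 0}"
    using assms(4) by force
  then show ?thesis
    using card_Un_Int[OF fin] assms by (simp add: fdist_def fwords_def)
qed

text \<open>Each configuration together with each zero-sum \<open>t\<close> gives one code. A word
  determines its block, and with it the configuration, by its support, and then \<open>t\<close> by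
  its symbols; so every word lies in exactly one of these codes.\<close>

lemma config_tiling:
  assumes ok: "list_all (ok_config v m) cfgs"
    and cov: "covers_triples v (concat cfgs)"
    and len: "length (concat cfgs) = v choose 3"
    and m: "0 < m" and v: "0 < v"
  shows "\<exists>P. tiling fdist (fwords (Suc m) {..<v}) (v * m) P \<and> card P = length cfgs * m ^ 3"
proof -
  define Z where "Z = {t :: nat \<Rightarrow> nat. (\<forall>c. t c < m) \<and> (\<forall>c\<ge>4. t c = 0) \<and> m dvd (\<Sum>c<4. t c)}"
  define pts where "pts b = set (map fst b)" for b :: block
  have okb: "ok_block v m b" if "b \<in> set cfg" "cfg \<in> set cfgs" for b cfg
    using ok that by (auto simp: list_all_iff ok_config_def)
  have okp: "ok_pair b b'" if "b \<in> set cfg" "b' \<in> set cfg" "cfg \<in> set cfgs" "b \<noteq> b'" for b b' cfg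
    using ok that by (auto simp: list_all_iff ok_config_def)
  have block: "\<exists>p1 c1 s1 p2 c2 s2 p3 c3 s3. b = [(p1, c1, s1), (p2, c2, s2), (p3, c3, s3)] \<and>
      distinct [p1, p2, p3] \<and> distinct [c1, c2, c3] \<and> p1 < v \<and> p2 < v \<and> p3 < v \<and>
      c1 < 4 \<and> c2 < 4 \<and> c3 < 4 \<and> s1 < m \<and> s2 < m \<and> s3 < m"
    if "b \<in> set cfg" "cfg \<in> set cfgs" for b cfg
    using okb[OF that] by (auto simp: ok_block_def length_Suc_conv eval_nat_numeral)
  have triples: "{T. T \<subseteq> {..<v} \<and> card T = 3} \<subseteq> set (map pts (concat cfgs))"
  proof clarify
    fix T assume T: "T \<subseteq> {..<v}" "card T = 3"
    define l where "l = sorted_list_of_set T"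
    have "finite T" using T finite_subset by blast
    then have l: "set l = T" "length l = 3" "sorted_wrt (<) l"
      using T by (auto simp: l_def)
    then obtain x y z where "l = [x, y, z]"
      by (auto simp: length_Suc_conv eval_nat_numeral)
    with l have xyz: "T = {x, y, z}" "x < y" "y < z" by auto
    then have "[x, y, z] \<in> (\<lambda>b. sort (map fst b)) ` set (concat cfgs)"
      using cov T unfolding covers_triples_def list_all_iff Let_def by auto
    then obtain b where b: "b \<in> set (concat cfgs)" "[x, y, z] = sort (map fst b)"
      by (rule imageE)
    have "set (sort (map fst b)) = {x, y, z}"
      unfolding b(2)[symmetric] by simp
    then have "pts b = T"
      using xyz by (simp add: pts_def)
    with b show "T \<in> set (map pts (concat cfgs))" by auto
  qed
  \<comment> \<open>Pigeonhole: as many blocks as triples, with every triple present, leave no room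
    for a repetition.\<close>
  have "v choose 3 = card {T. T \<subseteq> {..<v} \<and> card T = 3}"
    by (simp add: n_subsets)
  also have "\<dots> \<le> card (set (map pts (concat cfgs)))"
    using triples by (intro card_mono) auto
  finally have "card (set (map pts (concat cfgs))) = length (map pts (concat cfgs))"
    using len card_length[of "map pts (concat cfgs)"] by simp
  then have dist: "distinct (map pts (concat cfgs))"
    by (rule card_distinct)
  have cfg_ne: "cfg \<noteq> []" if "cfg \<in> set cfgs" for cfg
    using ok that m v by (auto simp: list_all_iff ok_config_def)
  \<comment> \<open>Repeated empty lists would be invisible in the concatenation; as no
    configuration is empty, its distinctness carries over to \<open>cfgs\<close>.\<close>
  have "removeAll [] cfgs = cfgs"
    using cfg_ne by (intro removeAll_id) auto
  then have dcs: "distinct cfgs" and dc: "\<And>cfg. cfg \<in> set cfgs \<Longrightarrow> distinct cfg"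
    using dist by (auto simp: distinct_map distinct_concat_iff)
  have uniq: "cfg = cfg' \<and> b = b'"
    if "b \<in> set cfg" "cfg \<in> set cfgs" "b' \<in> set cfg'" "cfg' \<in> set cfgs" "pts b = pts b'" for b b' cfg cfg'
  proof -
    have "b = b'"
      using dist that inj_onD[of pts "set (concat cfgs)" b b'] by (auto simp: distinct_map)
    moreover from this have "cfg = cfg'"
      using dist that by (auto simp: distinct_map distinct_concat_iff)
    ultimately show ?thesis by simp
  qed
  have supp: "{p. word_of m b t p \<noteq> 0} = pts b" for b t
    by (simp only: word_of_support pts_def)
  have word: "word_of m b t \<in> fwords (Suc m) {..<v}" if b: "b \<in> set cfg" "cfg \<in> set cfgs" for b cfg t
  proof -
    have "word_of m b t p < Suc m" for p
      using m by (auto simp: word_of_def split: option.splits)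
    moreover have "pts b \<subseteq> {..<v}" "card (pts b) = 3"
      using block[OF b] by (auto simp: pts_def)
    ultimately show ?thesis
      unfolding fwords_def mem_Collect_eq supp by simp
  qed
  have solve: "\<exists>!t. t \<in> Z \<and> word_of m b t = f"
    if b: "b \<in> set cfg" "cfg \<in> set cfgs" and f: "f \<in> fwords (Suc m) {..<v}" "{p. f p \<noteq> 0} = pts b"
    for b cfg f
  proof -
    obtain p1 c1 s1 p2 c2 s2 p3 c3 s3 where
      B: "b = [(p1, c1, s1), (p2, c2, s2), (p3, c3, s3)]" "distinct [p1, p2, p3]"
      and c: "distinct [c1, c2, c3]" "c1 < 4" "c2 < 4" "c3 < 4" and s: "s1 < m" "s2 < m" "s3 < m"
      using block[OF b] by blast
    have pos: "f p1 \<noteq> 0" "f p2 \<noteq> 0" "f p3 \<noteq> 0" and zero: "\<And>p. p \<notin> {p1, p2, p3} \<Longrightarrow> f p = 0"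
      using f(2) by (auto simp: B pts_def set_eq_iff)
    have bd: "f p - 1 < m" for p
      using f(1) m by (cases "f p") (auto simp: fwords_def dest: spec[of _ p])
    let ?r = "\<lambda>p s. (f p - 1 + (m - s)) mod m"
    have eq: "Suc ((x + s) mod m) = f p \<longleftrightarrow> x = ?r p s" if "x < m" "s < m" "f p \<noteq> 0" for x s p
      using mod_shift_iff[OF that(1,2) bd[of p]] that(3) by (cases "f p") auto
    have "word_of m b t = f \<longleftrightarrow> t c1 = ?r p1 s1 \<and> t c2 = ?r p2 s2 \<and> t c3 = ?r p3 s3" if "t \<in> Z" for t
    proof -
      have t: "t c < m" for c using that by (simp add: Z_def)
      have "word_of m b t p = f p" if "p \<notin> {p1, p2, p3}" for p
        using zero[OF that] that by (simp add: word_of_def B)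
      then have "word_of m b t = f \<longleftrightarrow> (\<forall>p\<in>{p1, p2, p3}. word_of m b t p = f p)"
        unfolding fun_eq_iff by blast
      also have "\<dots> \<longleftrightarrow> Suc ((t c1 + s1) mod m) = f p1 \<and> Suc ((t c2 + s2) mod m) = f p2 \<and>
          Suc ((t c3 + s3) mod m) = f p3"
        using B(2) by (auto simp: word_of_def B)
      finally show ?thesis
        using eq t s pos by simp
    qed
    moreover have "\<exists>!t. t \<in> Z \<and> t c1 = ?r p1 s1 \<and> t c2 = ?r p2 s2 \<and> t c3 = ?r p3 s3"
      unfolding Z_def using m by (intro zero_sum_unique c) auto
    ultimately show ?thesis by (metis (no_types, lifting))
  qed
  define code where "code = (\<lambda>(cfg, t). (\<lambda>b. word_of m b t) ` set cfg)"
  have same: "cfg = cfg' \<and> t = t'"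
    if "cfg \<in> set cfgs" "cfg' \<in> set cfgs" "t \<in> Z" "t' \<in> Z"
      "f \<in> code (cfg, t)" "f \<in> code (cfg', t')" for cfg cfg' t t' f
  proof -
    from that obtain b b' where b: "b \<in> set cfg" "b' \<in> set cfg'"
      "f = word_of m b t" "f = word_of m b' t'" by (auto simp: code_def)
    then have "pts b = pts b'" using supp by metis
    then have "cfg = cfg'" "b = b'" using uniq b that by blast+
    moreover have "t = t'"
      using solve[OF b(1) that(1) word[OF b(1) that(1), of t] supp] b that(3,4) \<open>b = b'\<close> by metis
    ultimately show ?thesis by simp
  qed
  have ne: "code (cfg, t) \<noteq> {}" if "cfg \<in> set cfgs" for cfg t
    using cfg_ne[OF that] by (auto simp: code_def)
  have "inj_on code (set cfgs \<times> Z)"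
    using same ne by (intro inj_onI) (auto, (metis ex_in_conv)+)
  moreover have "card Z = m ^ 3"
    unfolding Z_def using m by (rule card_zero_sum)
  ultimately have "card (code ` (set cfgs \<times> Z)) = length cfgs * m ^ 3"
    using dcs by (simp add: card_image card_cartesian_product distinct_card)
  moreover have "tiling fdist (fwords (Suc m) {..<v}) (v * m) (code ` (set cfgs \<times> Z))"
    unfolding tiling_def
  proof (intro conjI ballI impI)
    show "partition_on (fwords (Suc m) {..<v}) (code ` (set cfgs \<times> Z))"
    proof (rule partition_onI)
      show "\<Union> (code ` (set cfgs \<times> Z)) = fwords (Suc m) {..<v}"
      proof
        show "fwords (Suc m) {..<v} \<subseteq> \<Union> (code ` (set cfgs \<times> Z))"
        proof
          fix f assume f: "f \<in> fwords (Suc m) {..<v}"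
          then have "{p. f p \<noteq> 0} \<in> set (map pts (concat cfgs))"
            using triples by (auto simp: fwords_def)
          then obtain b cfg where b: "b \<in> set cfg" "cfg \<in> set cfgs" "{p. f p \<noteq> 0} = pts b"
            by auto
          then obtain t where "t \<in> Z" "word_of m b t = f"
            using solve f by metis
          then show "f \<in> \<Union> (code ` (set cfgs \<times> Z))"
            using b by (auto simp: code_def)
        qed
      qed (use word in \<open>auto simp: code_def\<close>)
      show "disjnt A A'" if "A \<in> code ` (set cfgs \<times> Z)" "A' \<in> code ` (set cfgs \<times> Z)" "A \<noteq> A'"
        for A A'
        using that same unfolding disjnt_def by fast
      show "{} \<notin> code ` (set cfgs \<times> Z)" using ne by fastforce
    qed
  next
    fix C assume "C \<in> code ` (set cfgs \<times> Z)"
    then obtain cfg t where C: "cfg \<in> set cfgs" "t \<in> Z" "C = code (cfg, t)" by auto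
    have "inj_on (\<lambda>b. word_of m b t) (set cfg)"
      using uniq C supp by (intro inj_onI) metis
    then have "card C = length cfg"
      using dc C by (simp add: code_def card_image distinct_card)
    then show "3 * card C = v * m"
      using ok C by (auto simp: list_all_iff ok_config_def)
    fix f g assume fg: "f \<in> C" "g \<in> C" "f \<noteq> g"
    then obtain b b' where b: "b \<in> set cfg" "b' \<in> set cfg" "f = word_of m b t" "g = word_of m b' t"
      by (auto simp: C code_def)
    have ok': "ok_pair b b'"
      using okp b C fg by auto
    show "5 \<le> fdist f g"
    proof (rule fdist_ge_5)
      show "f \<in> fwords (Suc m) {..<v}" "g \<in> fwords (Suc m) {..<v}"
        using word b C by auto
      have "{x. f x \<noteq> 0} \<inter> {x. g x \<noteq> 0} = set (filter (\<lambda>p. p \<in> set (map fst b')) (map fst b))"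
        unfolding b supp by (auto simp: pts_def)
      then show "card ({x. f x \<noteq> 0} \<inter> {x. g x \<noteq> 0}) \<le> 1"
        using ok' card_length order_trans unfolding ok_pair_def by metis
      fix p assume "f p \<noteq> 0" "g p \<noteq> 0"
      then obtain c s c' s' where m1: "map_of b p = Some (c, s)" "map_of b' p = Some (c', s')"
        unfolding b by (auto simp: word_of_def split: option.splits)
      have "c = c' \<and> s \<noteq> s'"
        using ok' map_of_SomeD[OF m1(1)] map_of_SomeD[OF m1(2)]
        by (fastforce simp: ok_pair_def list_all_iff)
      moreover have "s < m" "s' < m"
        using okb[OF b(1) C(1)] okb[OF b(2) C(1)] map_of_SomeD[OF m1(1)] map_of_SomeD[OF m1(2)]
        by (auto simp: ok_block_def list_all_iff)
      moreover have "t c < m" using C by (simp add: Z_def)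
      ultimately have "(t c + s) mod m \<noteq> (t c' + s') mod m"
        by (auto simp: mod_if split: if_splits)
      then show "f p \<noteq> g p"
        using m1 by (simp add: b word_of_def)
    qed
  qed
  ultimately show ?thesis by blast
qed

section \<open>Verification of the two families of configurations\<close>

lemma config8_checks:
  "list_all (ok_config 8 3) (rotations config8)"
  "covers_triples 8 (concat (rotations config8))"
  "length (concat (rotations config8)) = 56" "length (rotations config8) = 7"
  by code_simp+

lemma config9_checks:
  "list_all (ok_config 9 2) (rotations config9)"
  "covers_triples 9 (concat (rotations config9))"
  "length (concat (rotations config9)) = 84" "length (rotations config9) = 14"
  by code_simp+

text \<open>Seven configurations with \<open>3 ^ 3\<close> choices of \<open>t\<close> each give 189
  codes.\<close>

lemma base_tiling_8: "\<exists>P. tiling hamming_dist (Hq 4 8 3) (8 * 3) P \<and> card P = 189"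
proof -
  have "length (concat (rotations config8)) = 8 choose 3"
    unfolding config8_checks(3) by (simp add: binomial_fact' eval_nat_numeral)
  from config_tiling[OF config8_checks(1,2) this] config8_checks(4)
  obtain P where "tiling fdist (fwords 4 {..<8::nat}) (8 * 3) P" "card P = 189"
    by auto
  then show ?thesis
    using tiling_Hq_of_fwords[of 4 "{..<8::nat}"] by fastforce
qed

text \<open>Fourteen configurations with \<open>2 ^ 3\<close> choices of \<open>t\<close> each give
  112 codes.\<close>

lemma base_tiling_9: "\<exists>P. tiling hamming_dist (Hq 3 9 3) (9 * 2) P \<and> card P = 112"
proof -
  have "length (concat (rotations config9)) = 9 choose 3"
    unfolding config9_checks(3) by (simp add: binomial_fact' eval_nat_numeral)
  from config_tiling[OF config9_checks(1,2) this] config9_checks(4)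
  obtain P where "tiling fdist (fwords 3 {..<9::nat}) (9 * 2) P" "card P = 112"
    by auto
  then show ?thesis
    using tiling_Hq_of_fwords[of 3 "{..<9::nat}"] by fastforce
qed

section \<open>Parallel classes of sublines\<close>

text \<open>The polynomial splits into linear factors, and a factor occurring twice would give a
  common root with the derivative.\<close>

lemma card_roots_separable:
  fixes p :: "'a :: alg_closed_field poly"
  assumes "p \<noteq> 0" and sep: "\<And>x. poly p x = 0 \<Longrightarrow> poly (pderiv p) x \<noteq> 0"
  shows "card {x. poly p x = 0} = Polynomial.degree p"
proof -
  obtain A l where A: "size A = Polynomial.degree p" "p = smult l (\<Prod>x\<in>#A. [:-x, 1:])"
    using alg_closed_imp_factorization[OF assms(1)] by blast
  have "l \<noteq> 0" using assms(1) A(2) by auto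
  then have roots: "{x. poly p x = 0} = set_mset A"
    by (subst A(2)) (auto simp: poly_prod_mset prod_mset_zero_iff)
  have "count A x = 1" if "x \<in># A" for x
  proof (rule ccontr)
    assume "count A x \<noteq> 1"
    moreover have "0 < count A x" using that by simp
    ultimately have "x \<in># A - {#x#}"
      by (simp add: in_diff_count del: count_greater_zero_iff)
    then have A': "A = add_mset x (add_mset x (A - {#x#} - {#x#}))"
      using that by (simp only: insert_DiffM)
    define r where "r = smult l (\<Prod>x\<in>#A - {#x#} - {#x#}. [:-x, 1:])"
    have "p = [:-x, 1:] * ([:-x, 1:] * r)"
      unfolding r_def by (subst A(2), subst A') simp
    then have "pderiv p = [:-x, 1:] * pderiv ([:-x, 1:] * r) + ([:-x, 1:] * r) * pderiv [:-x, 1:]"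
      by (simp only: pderiv_mult)
    then have "poly (pderiv p) x = 0"
      by simp
    moreover have "poly p x = 0"
      using that roots by auto
    ultimately show False
      using sep by blast
  qed
  then have "size A = card (set_mset A)"
    by (simp add: size_multiset_overloaded_eq)
  then show ?thesis
    using A roots by simp
qed

text \<open>The derivative of \<open>X ^ N - X\<close> is the constant -1, as \<open>N\<close>
  vanishes in the field. For \<open>N\<close> a power of the characteristic the roots form the
  subfield with \<open>N\<close> elements.\<close>

lemma card_fixed_points_power:
  assumes "of_nat N = (0 :: 'a :: alg_closed_field)" "1 < N"
  shows "card {x :: 'a. x ^ N = x} = N"
proof -
  define p :: "'a poly" where "p = Polynomial.monom 1 N - Polynomial.monom 1 1"
  have "Polynomial.degree p = N"
    unfolding p_def diff_conv_add_uminus using assms(2)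
    by (subst degree_add_eq_left) (auto simp: degree_monom_eq)
  moreover have "p \<noteq> 0"
    using calculation assms(2) by auto
  moreover have "poly (pderiv p) x \<noteq> 0" for x
    by (simp add: p_def pderiv_diff pderiv_monom assms(1) poly_monom)
  ultimately have "card {x. poly p x = 0} = N"
    using card_roots_separable by metis
  then show ?thesis
    by (simp add: p_def poly_monom)
qed

text \<open>The derivative \<open>N * X ^ (N - 1)\<close> of \<open>X ^ N - 1\<close> vanishes at
  most at 0, which is not a root.\<close>

lemma card_roots_unity:
  assumes "of_nat N \<noteq> (0 :: 'a :: alg_closed_field)"
  shows "card {x :: 'a. x ^ N = 1} = N"
proof -
  have N: "0 < N" using assms by (auto intro: Nat.gr0I)
  define p :: "'a poly" where "p = Polynomial.monom 1 N - Polynomial.monom 1 0"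
  have "Polynomial.degree p = N"
    unfolding p_def diff_conv_add_uminus using N
    by (subst degree_add_eq_left) (auto simp: degree_monom_eq)
  moreover have "p \<noteq> 0"
    using calculation N by auto
  moreover have "poly (pderiv p) x \<noteq> 0" if "poly p x = 0" for x
    using that assms N by (auto simp: p_def pderiv_diff pderiv_monom poly_monom zero_power)
  ultimately have "card {x. poly p x = 0} = N"
    using card_roots_separable by metis
  then show ?thesis
    by (simp add: p_def poly_monom)
qed

text \<open>Induction in steps of two, by
  \<open>q ^ (k + 2) + 1 = q ^ 2 * (q ^ k + 1) - (q - 1) * (q + 1)\<close>, computed in the integers
  to avoid truncated subtraction.\<close>

lemma dvd_power_plus_one:
  fixes q :: nat
  assumes "odd n"
  shows "q + 1 dvd q ^ n + 1"
proof -
  obtain k where "n = 2 * k + 1" using assms by (auto elim: oddE)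
  moreover have "q + 1 dvd q ^ (2 * k + 1) + 1"
  proof (induction k)
    case (Suc k)
    have "int (q ^ (2 * Suc k + 1) + 1) =
        int q ^ 2 * int (q ^ (2 * k + 1) + 1) - (int q - 1) * int (q + 1)"
      by (simp add: algebra_simps power2_eq_square)
    moreover have "int (q + 1) dvd int (q ^ (2 * k + 1) + 1)"
      using Suc by (simp only: of_nat_dvd_iff)
    ultimately have "int (q + 1) dvd int (q ^ (2 * Suc k + 1) + 1)"
      by (simp only: dvd_diff dvd_mult dvd_refl)
    then show ?case by (simp only: of_nat_dvd_iff)
  qed simp
  ultimately show ?thesis by simp
qed

text \<open>The set \<open>H\<close> takes one element from each orbit of a fixed-point-free
  involution. It will select one parameter from each conjugate pair.\<close>

lemma ex_half_set:
  assumes "\<And>x. x \<in> A \<Longrightarrow> s x \<in> A" "\<And>x. x \<in> A \<Longrightarrow> s (s x) = x" "\<And>x. x \<in> A \<Longrightarrow> s x \<noteq> x"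
  shows "\<exists>H\<subseteq>A. \<forall>x\<in>A. x \<in> H \<longleftrightarrow> s x \<notin> H"
proof -
  define H where "H = {x\<in>A. x = (SOME y. y \<in> {x, s x})}"
  have "x \<in> H \<longleftrightarrow> s x \<notin> H" if x: "x \<in> A" for x
  proof -
    \<comment> \<open>For \<open>x\<close> and \<open>s x\<close> the choice is made from the same
      set, so exactly one of them is chosen.\<close>
    have e: "{s x, s (s x)} = {x, s x}" using assms(2)[OF x] by auto
    define y where "y = (SOME y. y \<in> {x, s x})"
    have "y \<in> {x, s x}" unfolding y_def by (rule someI[of _ x]) simp
    moreover have "x \<in> H \<longleftrightarrow> x = y" "s x \<in> H \<longleftrightarrow> s x = y"
      using assms(1)[OF x] x unfolding H_def mem_Collect_eq e y_def by simp_all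
    ultimately show ?thesis
      using assms(3)[OF x] by auto
  qed
  moreover have "H \<subseteq> A" by (auto simp: H_def)
  ultimately show ?thesis by blast
qed

text \<open>The involution exchanges \<open>S \<inter> H\<close> and \<open>S - H\<close>.\<close>

lemma card_half_set:
  assumes H: "\<forall>x\<in>S. x \<in> H \<longleftrightarrow> s x \<notin> H" and S: "finite S" "\<And>x. x \<in> S \<Longrightarrow> s x \<in> S"
    and inv: "\<And>x. x \<in> S \<Longrightarrow> s (s x) = x"
  shows "card S = 2 * card (S \<inter> H)"
proof -
  have "bij_betw s (S \<inter> H) (S - H)"
  proof (rule bij_betw_byWitness[where f' = s])
    show "s ` (S \<inter> H) \<subseteq> S - H" using H S(2) by blast
    show "s ` (S - H) \<subseteq> S \<inter> H" using H S(2) by blast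
  qed (simp_all add: inv)
  then have "card (S \<inter> H) = card (S - H)"
    by (rule bij_betw_same_card)
  moreover have "card S = card (S \<inter> H) + card (S - H)"
    using S card_Un_disjoint[of "S \<inter> H" "S - H"] by (simp add: Int_Diff_disjoint Int_Diff_Un)
  ultimately show ?thesis by simp
qed

section \<open>The projective line over \<open>F\<close> and its parallel classes\<close>

text \<open>All finite fields involved are taken inside one algebraically closed field, as solution
  sets of equations \<open>x ^ N = x\<close>.\<close>

locale subline_geometry =
  fixes ty :: "'a :: alg_closed_field itself" and q n Q :: nat
  assumes prime_char: "Factorial_Ring.prime CHAR('a)" and ex_q: "\<exists>e>0. q = CHAR('a) ^ e"
    and odd_n: "odd n" and Q_def: "Q = q ^ n"
begin

lemma q_gt_1: "1 < q"
  using ex_q one_less_power[OF prime_gt_1_nat[OF prime_char]] by blast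

lemma Q_gt_1: "1 < Q"
  unfolding Q_def by (rule one_less_power[OF q_gt_1 odd_pos[OF odd_n]])

lemma of_nat_q [simp]: "of_nat q = (0 :: 'a)"
  using ex_q prime_char by (auto simp: zero_power)

lemma of_nat_Q [simp]: "of_nat Q = (0 :: 'a)"
  using odd_n by (simp add: Q_def odd_pos)

lemma frob_add: "(x + y :: 'a) ^ q = x ^ q + y ^ q" "(x + y :: 'a) ^ Q = x ^ Q + y ^ Q"
proof -
  obtain e where e: "q = CHAR('a) ^ e" using ex_q by blast
  show "(x + y) ^ q = x ^ q + y ^ q"
    by (rule freshmans_dream'[OF prime_char e])
  show "(x + y) ^ Q = x ^ Q + y ^ Q"
    by (rule freshmans_dream'[OF prime_char, where n = "e * n"]) (simp add: Q_def e power_mult)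
qed

lemma frob_diff: "(x - y :: 'a) ^ q = x ^ q - y ^ q" "(x - y :: 'a) ^ Q = x ^ Q - y ^ Q"
  using frob_add[of "x - y" y] by simp_all

lemma Q_pos [simp]: "0 < Q" and q_pos [simp]: "0 < q"
  using Q_gt_1 q_gt_1 by simp_all

definition F :: "'a set" where "F = {x. x ^ Q = x}"

text \<open>The point at infinity is \<open>None\<close>.\<close>

definition PL :: "'a option set" where "PL = insert None (Some ` F)"

text \<open>These are the elements of the quadratic extension of \<open>F\<close> outside
  \<open>F\<close>; the conjugate of \<open>\<tau>\<close> is \<open>\<tau> ^ Q\<close>.\<close>

definition T :: "'a set" where "T = {\<tau>. (\<tau> ^ Q) ^ Q = \<tau> \<and> \<tau> ^ Q \<noteq> \<tau>}"

fun phi :: "'a \<Rightarrow> 'a option \<Rightarrow> 'a" where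
  "phi \<tau> None = 1"
| "phi \<tau> (Some x) = (x - \<tau>) / (x - \<tau> ^ Q)"

text \<open>Equal powers mean that the two images lie in one coset of the \<open>(q + 1)\<close>-th
  roots of unity.\<close>

definition rel :: "'a \<Rightarrow> 'a option \<Rightarrow> 'a option \<Rightarrow> bool" where
  "rel \<tau> x y \<longleftrightarrow> phi \<tau> x ^ (q + 1) = phi \<tau> y ^ (q + 1)"

definition cls :: "'a \<Rightarrow> 'a option set set" where
  "cls \<tau> = (\<lambda>x. {y\<in>PL. rel \<tau> x y}) ` PL"

lemma F_D: "x \<in> F \<Longrightarrow> x ^ Q = x"
  by (simp add: F_def)

lemma F_closed:
  assumes "x \<in> F" "y \<in> F"
  shows "x + y \<in> F" "x - y \<in> F" "x * y \<in> F"
  using assms by (simp_all add: F_def frob_add frob_diff power_mult_distrib)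

lemma F_inverse: "x \<in> F \<Longrightarrow> inverse x \<in> F"
  by (simp add: F_def power_inverse)

lemma F_01 [simp]: "0 \<in> F" "1 \<in> F"
  by (simp_all add: F_def)

lemma card_F: "card F = Q"
  unfolding F_def by (rule card_fixed_points_power[OF of_nat_Q Q_gt_1])

lemma finite_F: "finite F"
  using card_F Q_pos by (metis card_ge_0_finite)

lemma PL_simps [simp]: "None \<in> PL" "Some x \<in> PL \<longleftrightarrow> x \<in> F"
  by (auto simp: PL_def)

lemma finite_PL: "finite PL" and card_PL: "card PL = Q + 1"
  using finite_F by (auto simp: PL_def card_F card_image)

lemma finite_T: "finite T"
proof -
  have "card {x :: 'a. x ^ (Q * Q) = x} = Q * Q"
    by (rule card_fixed_points_power[OF _ less_1_mult[OF Q_gt_1 Q_gt_1]]) simp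
  then have "finite {x :: 'a. x ^ (Q * Q) = x}"
    using Q_pos by (metis card_ge_0_finite nat_0_less_mult_iff)
  then show ?thesis
    by (rule rev_finite_subset) (auto simp: T_def power_mult)
qed

lemma T_D: "\<tau> \<in> T \<Longrightarrow> (\<tau> ^ Q) ^ Q = \<tau>" "\<tau> \<in> T \<Longrightarrow> \<tau> ^ Q \<noteq> \<tau>"
  by (auto simp: T_def)

lemma T_conj: "\<tau> \<in> T \<Longrightarrow> \<tau> ^ Q \<in> T"
  by (auto simp: T_def)

lemma T_not_F: "\<tau> \<in> T \<Longrightarrow> x \<in> F \<Longrightarrow> x \<noteq> \<tau>" "\<tau> \<in> T \<Longrightarrow> x \<in> F \<Longrightarrow> x \<noteq> \<tau> ^ Q"
  by (auto simp: T_def F_def)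

lemma phi_nonzero: "\<tau> \<in> T \<Longrightarrow> x \<in> PL \<Longrightarrow> phi \<tau> x \<noteq> 0"
  by (cases x) (auto dest: T_not_F)

text \<open>Conjugating the parameter exchanges numerator and denominator.\<close>

lemma phi_conj: "\<tau> \<in> T \<Longrightarrow> phi (\<tau> ^ Q) x = inverse (phi \<tau> x)"
  by (cases x) (auto simp: T_D)

lemma rel_conj: "\<tau> \<in> T \<Longrightarrow> rel (\<tau> ^ Q) x y \<longleftrightarrow> rel \<tau> x y"
  by (simp add: rel_def phi_conj power_inverse flip: power_Suc)

text \<open>Raising to the power \<open>Q\<close> fixes the points of \<open>F\<close> and exchanges
  \<open>\<tau>\<close> with its conjugate, so it inverts \<open>phi \<tau> x\<close>.\<close>

lemma phi_norm:
  assumes "\<tau> \<in> T" "x \<in> PL"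
  shows "phi \<tau> x ^ (Q + 1) = 1"
proof (cases x)
  case (Some y)
  then have y: "y \<in> F" using assms by simp
  have "phi \<tau> x ^ Q = (y - \<tau> ^ Q) / (y - \<tau>)"
    using assms y by (simp add: Some power_divide frob_diff F_D T_D)
  then show ?thesis
    using T_not_F[OF assms(1) y] by (simp add: Some)
qed simp

lemma phi_bij:
  assumes \<tau>: "\<tau> \<in> T"
  shows "bij_betw (phi \<tau>) PL {u. u ^ (Q + 1) = 1}"
proof (rule bij_betw_imageI)
  have one: "phi \<tau> (Some x) \<noteq> 1" if "x \<in> F" for x
    using T_not_F(2)[OF \<tau> that] T_D(2)[OF \<tau>] by (simp add: field_simps)
  have two: "x = y" if "x \<in> F" "y \<in> F" "phi \<tau> (Some x) = phi \<tau> (Some y)" for x y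
  proof -
    have "(x - \<tau>) * (y - \<tau> ^ Q) = (y - \<tau>) * (x - \<tau> ^ Q)"
      using that T_not_F(2)[OF \<tau>] by (simp add: frac_eq_eq)
    then have "(\<tau> - \<tau> ^ Q) * (x - y) = 0"
      by (simp add: algebra_simps)
    then show ?thesis using T_D(2)[OF \<tau>] by auto
  qed
  show "inj_on (phi \<tau>) PL"
    using one two by (auto simp: inj_on_def PL_def simp del: phi.simps(2))
  show "phi \<tau> ` PL = {u. u ^ (Q + 1) = 1}"
  proof (intro equalityI subsetI)
    fix u assume "u \<in> {u. u ^ (Q + 1) = (1::'a)}"
    then have u: "u ^ Q * u = 1" by (simp add: mult.commute)
    then have u0: "u \<noteq> 0" by auto
    have uQ: "u ^ Q = inverse u" using u by (simp add: inverse_unique mult.commute)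
    show "u \<in> phi \<tau> ` PL"
    proof (cases "u = 1")
      case True
      then show ?thesis by (intro image_eqI[of _ _ None]) auto
    next
      case False
      \<comment> \<open>The solution of \<open>(x - \<tau>) / (x - \<tau> ^ Q) = u\<close>; since
        \<open>u ^ Q\<close> is the inverse of \<open>u\<close>, it is fixed by the power
        \<open>Q\<close>.\<close>
      define x where "x = (\<tau> - u * \<tau> ^ Q) / (1 - u)"
      have "x ^ Q = (\<tau> ^ Q - inverse u * \<tau>) / (1 - inverse u)"
        by (simp add: x_def power_divide frob_diff power_mult_distrib uQ T_D[OF \<tau>])
      also have "\<dots> = x"
        using u0 False by (simp add: x_def field_simps)
      finally have x: "x \<in> F" by (simp add: F_def)
      have "x - \<tau> = u * (x - \<tau> ^ Q)"
        using False by (simp add: x_def field_simps)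
      then have "phi \<tau> (Some x) = u"
        using T_not_F(2)[OF \<tau> x] by simp
      then show ?thesis using x by (intro image_eqI[of _ _ "Some x"]) auto
    qed
  qed (use phi_norm[OF \<tau>] in auto)
qed

text \<open>Under \<open>phi \<tau>\<close> the block becomes the coset of
  \<open>phi \<tau> x\<close> by the \<open>(q + 1)\<close>-th roots of unity. The whole coset is
  attained because \<open>q + 1\<close> divides \<open>Q + 1\<close>.\<close>

lemma card_block:
  assumes "\<tau> \<in> T" "x \<in> PL"
  shows "card {y\<in>PL. rel \<tau> x y} = q + 1"
proof -
  let ?w = "phi \<tau> x"
  have w: "?w \<noteq> 0" by (rule phi_nonzero[OF assms])
  obtain k where k: "Q + 1 = (q + 1) * k"
    using dvd_power_plus_one[OF odd_n, of q] by (auto simp: Q_def)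
  have "u ^ (Q + 1) = 1" if "u ^ (q + 1) = ?w ^ (q + 1)" for u
    unfolding k power_mult that using phi_norm[OF assms] by (simp only: k power_mult)
  then have b1: "bij_betw (phi \<tau>) {y\<in>PL. rel \<tau> x y} {u. u ^ (q + 1) = ?w ^ (q + 1)}"
    using phi_bij[OF assms(1)] unfolding bij_betw_def rel_def
    by (auto simp: inj_on_def image_iff simp del: power_Suc) (metis (mono_tags) mem_Collect_eq imageE)
  have b2: "bij_betw ((*) ?w) {u. u ^ (q + 1) = 1} {u. u ^ (q + 1) = ?w ^ (q + 1)}"
    by (rule bij_betw_byWitness[where f' = "\<lambda>u. u / ?w"])
      (use w in \<open>auto simp: power_mult_distrib power_divide simp del: power_Suc\<close>)
  have "card {u :: 'a. u ^ (q + 1) = 1} = q + 1"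
    by (rule card_roots_unity) simp
  then show ?thesis
    by (simp only: bij_betw_same_card[OF b1] bij_betw_same_card[OF b2, symmetric])
qed

lemma partition_cls: "partition_on PL (cls \<tau>)"
  by (rule partition_onI) (auto simp: cls_def disjnt_def rel_def)

lemma cls_D:
  assumes "B \<in> cls \<tau>" "a \<in> B"
  shows "B = {x\<in>PL. rel \<tau> a x}" "a \<in> PL"
  using assms by (auto simp: cls_def rel_def)

section \<open>The block through three points\<close>

text \<open>The count includes both members of each conjugate pair. The second part says that the
  block containing the three points is the same for all these parameters.\<close>

definition subline_triple :: "'a option \<Rightarrow> 'a option \<Rightarrow> 'a option \<Rightarrow> bool" where
  "subline_triple a b c \<longleftrightarrow> card {\<tau>\<in>T. rel \<tau> a b \<and> rel \<tau> a c} = q ^ 2 - q \<and>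
     (\<exists>B. \<forall>\<tau>\<in>T. rel \<tau> a b \<and> rel \<tau> a c \<longrightarrow> {x\<in>PL. rel \<tau> a x} = B)"

text \<open>For \<open>\<infinity>\<close>, 0, 1 the parameters in question are the elements of the quadratic extension of
  \<open>F\<^sub>q\<close> outside \<open>F\<^sub>q\<close>: the conditions say that \<open>\<tau>, \<tau> ^ q\<close> and \<open>\<tau> ^ Q, (\<tau> ^ Q) ^ q\<close> have the same sum
  and product, hence \<open>\<tau> ^ Q = \<tau> ^ q\<close>.\<close>

lemma rel_None_Some:
  assumes "\<tau> \<in> T" "x \<in> F"
  shows "rel \<tau> None (Some x) \<longleftrightarrow>
    (x - \<tau>) * (x ^ q - \<tau> ^ q) = (x - \<tau> ^ Q) * (x ^ q - (\<tau> ^ Q) ^ q)"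
proof -
  have "rel \<tau> None (Some x) \<longleftrightarrow> (x - \<tau>) ^ (q + 1) = (x - \<tau> ^ Q) ^ (q + 1)"
    using T_not_F(2)[OF assms] by (auto simp: rel_def power_divide simp del: power_Suc)
  then show ?thesis
    by (simp add: frob_diff)
qed

text \<open>The power \<open>q\<close> acts on \<open>\<tau>\<close> with order dividing 2, and
  \<open>n\<close> is odd.\<close>

lemma frob_quadratic:
  assumes "((\<tau> :: 'a) ^ q) ^ q = \<tau>"
  shows "\<tau> ^ Q = \<tau> ^ q"
proof -
  obtain k where k: "n = 2 * k + 1" using odd_n by (auto elim: oddE)
  have fixed: "\<tau> ^ (q ^ (2 * j)) = \<tau>" for j
    by (induction j) (use assms in \<open>simp_all add: power_mult mult.assoc\<close>)
  have "\<tau> ^ Q = (\<tau> ^ (q ^ (2 * k))) ^ q"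
    by (simp only: Q_def k power_add power_one_right power_mult)
  then show ?thesis
    by (simp only: fixed)
qed

lemma standard_triple_iff:
  "\<tau> \<in> T \<and> rel \<tau> None (Some 0) \<and> rel \<tau> None (Some 1) \<longleftrightarrow> (\<tau> ^ q) ^ q = \<tau> \<and> \<tau> ^ q \<noteq> \<tau>"
  (is "?L \<longleftrightarrow> ?R")
proof
  assume L: ?L
  define s where "s = \<tau> ^ Q"
  have 0: "\<tau> * \<tau> ^ q = s * s ^ q"
    using L rel_None_Some[of \<tau> 0] by (simp add: s_def zero_power)
  have 1: "\<tau> + \<tau> ^ q = s + s ^ q"
    using L rel_None_Some[of \<tau> 1] 0 by (simp add: algebra_simps s_def)
  \<comment> \<open>Equal sums and products make \<open>s\<close> a root of
    \<open>(X - \<tau>) * (X - \<tau> ^ q)\<close>, and \<open>s\<close> differs from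
    \<open>\<tau>\<close>.\<close>
  have "(s - \<tau>) * (s - \<tau> ^ q) = s * s - s * (\<tau> + \<tau> ^ q) + \<tau> * \<tau> ^ q"
    by (simp add: algebra_simps)
  also have "\<dots> = 0"
    unfolding 0 1 by (simp add: algebra_simps)
  finally have s: "\<tau> ^ Q = \<tau> ^ q"
    using L T_D(2) by (auto simp: s_def)
  have "(\<tau> ^ q) ^ q = (\<tau> ^ Q) ^ q" by (simp only: s)
  also have "\<dots> = (\<tau> ^ q) ^ Q" by (simp add: mult.commute flip: power_mult)
  also have "\<dots> = \<tau>" unfolding s[symmetric] using T_D(1) L by blast
  finally show ?R using s L T_D(2) by auto
next
  assume R: ?R
  have s: "\<tau> ^ Q = \<tau> ^ q"
    using R frob_quadratic by simp
  have "(\<tau> ^ Q) ^ Q = (\<tau> ^ Q) ^ q"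
    by (simp only: s flip: power_mult) (simp only: s mult.commute power_mult)
  then have T: "\<tau> \<in> T"
    using R s by (simp add: T_def)
  moreover have "rel \<tau> None (Some 0)" "rel \<tau> None (Some 1)"
    using R by (simp_all add: rel_None_Some[OF T] s algebra_simps)
  ultimately show ?L by simp
qed

lemma subline_triple_standard: "subline_triple None (Some 0) (Some 1)"
proof -
  let ?K = "{x :: 'a. x ^ q = x}" and ?L = "{x :: 'a. (x ^ q) ^ q = x}"
  have "card {x :: 'a. x ^ (q * q) = x} = q * q"
    by (rule card_fixed_points_power[OF _ less_1_mult[OF q_gt_1 q_gt_1]]) simp
  then have L: "card ?L = q ^ 2"
    by (simp add: power_mult power2_eq_square)
  have K: "card ?K = q"
    by (rule card_fixed_points_power[OF of_nat_q q_gt_1])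
  have "card (?L - ?K) = q ^ 2 - q"
    using L K q_pos by (subst card_Diff_subset) (auto intro: card_ge_0_finite)
  moreover have "{\<tau>\<in>T. rel \<tau> None (Some 0) \<and> rel \<tau> None (Some 1)} = ?L - ?K"
    using standard_triple_iff by auto
  \<comment> \<open>For all these parameters the block is the projective line over the field with
    \<open>q\<close> elements.\<close>
  moreover have "{x\<in>PL. rel \<tau> None x} = insert None (Some ` (F \<inter> ?K))"
    if \<tau>: "\<tau> \<in> T" "rel \<tau> None (Some 0)" "rel \<tau> None (Some 1)" for \<tau>
  proof -
    have R: "(\<tau> ^ q) ^ q = \<tau>" "\<tau> ^ q \<noteq> \<tau>" using standard_triple_iff \<tau> by blast+
    have s: "\<tau> ^ Q = \<tau> ^ q" by (rule frob_quadratic[OF R(1)])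
    have "rel \<tau> None (Some x) \<longleftrightarrow> x ^ q = x" if "x \<in> F" for x
    proof -
      have "rel \<tau> None (Some x) \<longleftrightarrow> (\<tau> - \<tau> ^ q) * (x - x ^ q) = 0"
        unfolding rel_None_Some[OF \<tau>(1) that] s R by (auto simp: algebra_simps)
      then show ?thesis using R by auto
    qed
    then show ?thesis by (auto simp: PL_def rel_def)
  qed
  ultimately show ?thesis
    unfolding subline_triple_def by auto
qed

text \<open>Translations, scalings and the inversion act compatibly on points and parameters, and
  together they move \<open>\<infinity>\<close>, 0, 1 to any three points.\<close>

lemma subline_triple_swap:
  assumes "subline_triple a b c"
  shows "subline_triple b a c" "subline_triple a c b"
proof -
  have S: "rel \<tau> b a \<and> rel \<tau> b c \<longleftrightarrow> rel \<tau> a b \<and> rel \<tau> a c" for \<tau>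
    by (auto simp: rel_def)
  have B: "{x\<in>PL. rel \<tau> b x} = {x\<in>PL. rel \<tau> a x}" if "rel \<tau> a b" for \<tau>
    using that by (auto simp: rel_def)
  show "subline_triple b a c"
    using assms unfolding subline_triple_def S using B by auto
  show "subline_triple a c b"
    using assms unfolding subline_triple_def by (simp add: conj_commute)
qed

text \<open>The map \<open>\<mu>\<close> carries the parameters for \<open>a\<close>,
  \<open>b\<close>, \<open>c\<close> onto those for the image points, and the common block
  \<open>B\<close> becomes its image under \<open>g\<close>.\<close>

lemma subline_triple_transfer:
  assumes \<mu>: "bij_betw \<mu> T T" and g: "bij_betw g PL PL"
    and rel: "\<And>\<tau> x y. \<tau> \<in> T \<Longrightarrow> x \<in> PL \<Longrightarrow> y \<in> PL \<Longrightarrow> rel (\<mu> \<tau>) (g x) (g y) \<longleftrightarrow> rel \<tau> x y"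
    and abc: "a \<in> PL" "b \<in> PL" "c \<in> PL" and abc_sub: "subline_triple a b c"
  shows "subline_triple (g a) (g b) (g c)"
proof -
  let ?S = "{\<tau>\<in>T. rel \<tau> a b \<and> rel \<tau> a c}"
  have S: "{\<tau>\<in>T. rel \<tau> (g a) (g b) \<and> rel \<tau> (g a) (g c)} = \<mu> ` ?S" (is "?S' = _")
  proof (intro equalityI subsetI)
    fix \<sigma> assume \<sigma>: "\<sigma> \<in> ?S'"
    then obtain \<tau> where "\<tau> \<in> T" "\<sigma> = \<mu> \<tau>" using \<mu> by (auto simp: bij_betw_def)
    then show "\<sigma> \<in> \<mu> ` ?S" using \<sigma> rel abc by auto
  next
    fix \<sigma> assume "\<sigma> \<in> \<mu> ` ?S"
    then show "\<sigma> \<in> ?S'" using rel abc bij_betwE[OF \<mu>] by auto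
  qed
  have "inj_on \<mu> ?S"
    using \<mu> by (auto simp: bij_betw_def inj_on_def)
  then have "card ?S' = q ^ 2 - q"
    using S abc_sub by (simp add: card_image subline_triple_def)
  moreover obtain B where B: "\<And>\<tau>. \<tau> \<in> ?S \<Longrightarrow> {x\<in>PL. rel \<tau> a x} = B"
  proof -
    obtain B where "\<forall>\<tau>\<in>T. rel \<tau> a b \<and> rel \<tau> a c \<longrightarrow> {x\<in>PL. rel \<tau> a x} = B"
      using abc_sub unfolding subline_triple_def by auto
    then show thesis by (intro that[of B]) auto
  qed
  have "{x\<in>PL. rel \<sigma> (g a) x} = g ` B" if \<sigma>: "\<sigma> \<in> ?S'" for \<sigma>
  proof -
    obtain \<tau> where \<tau>: "\<sigma> = \<mu> \<tau>" "\<tau> \<in> ?S" using \<sigma> unfolding S by (rule imageE)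
    have "{x\<in>PL. rel \<sigma> (g a) x} = g ` {x\<in>PL. rel \<tau> a x}"
    proof (intro equalityI subsetI)
      fix y assume y: "y \<in> {x\<in>PL. rel \<sigma> (g a) x}"
      then obtain x where "x \<in> PL" "y = g x" using g by (auto simp: bij_betw_def)
      then show "y \<in> g ` {x\<in>PL. rel \<tau> a x}" using y \<tau> rel abc by auto
    next
      fix y assume "y \<in> g ` {x\<in>PL. rel \<tau> a x}"
      then show "y \<in> {x\<in>PL. rel \<sigma> (g a) x}" using \<tau> rel abc bij_betwE[OF g] by auto
    qed
    then show ?thesis using B[OF \<tau>(2)] by simp
  qed
  ultimately show ?thesis
    unfolding subline_triple_def by (intro conjI exI[of _ "g ` B"]) auto
qed

lemma subline_triple_translate:
  assumes t: "t \<in> F" and abc: "a \<in> PL" "b \<in> PL" "c \<in> PL" and abc_sub: "subline_triple a b c"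
  shows "subline_triple (map_option ((+) t) a) (map_option ((+) t) b) (map_option ((+) t) c)"
proof (rule subline_triple_transfer[where \<mu> = "(+) t", OF _ _ _ abc abc_sub])
  show "bij_betw ((+) t) T T"
    by (rule bij_betw_byWitness[where f' = "\<lambda>x. x - t"])
      (use t in \<open>auto simp: T_def frob_add frob_diff F_D\<close>)
  show "bij_betw (map_option ((+) t)) PL PL"
    by (rule bij_betw_byWitness[where f' = "map_option (\<lambda>x. x - t)"])
      (use t in \<open>auto simp: PL_def F_inverse F_closed option.map_comp o_def\<close>)
  have "phi (t + \<tau>) (map_option ((+) t) x) = phi \<tau> x" for \<tau> x
    by (cases x) (simp_all add: frob_add F_D[OF t])
  then show "rel (t + \<tau>) (map_option ((+) t) x) (map_option ((+) t) y) \<longleftrightarrow> rel \<tau> x y" for \<tau> x y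
    by (simp add: rel_def)
qed

lemma subline_triple_scale:
  assumes t: "t \<in> F" "t \<noteq> 0" and abc: "a \<in> PL" "b \<in> PL" "c \<in> PL" and abc_sub: "subline_triple a b c"
  shows "subline_triple (map_option ((*) t) a) (map_option ((*) t) b) (map_option ((*) t) c)"
proof (rule subline_triple_transfer[where \<mu> = "(*) t", OF _ _ _ abc abc_sub])
  show "bij_betw ((*) t) T T"
    by (rule bij_betw_byWitness[where f' = "(*) (inverse t)"])
      (use t in \<open>auto simp: T_def power_mult_distrib power_inverse F_D\<close>)
  show "bij_betw (map_option ((*) t)) PL PL"
    by (rule bij_betw_byWitness[where f' = "map_option ((*) (inverse t))"])
      (use t in \<open>auto simp: PL_def F_inverse F_closed option.map_comp o_def\<close>)
  have "phi (t * \<tau>) (map_option ((*) t) x) = phi \<tau> x" for \<tau> x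
    using t(2) by (cases x) (simp_all add: power_mult_distrib F_D[OF t(1)] flip: right_diff_distrib)
  then show "rel (t * \<tau>) (map_option ((*) t) x) (map_option ((*) t) y) \<longleftrightarrow> rel \<tau> x y" for \<tau> x y
    by (simp add: rel_def)
qed

definition inv_pt :: "'a option \<Rightarrow> 'a option" where
  "inv_pt x = (case x of None \<Rightarrow> Some 0 | Some y \<Rightarrow> if y = 0 then None else Some (inverse y))"

lemma subline_triple_invert:
  assumes abc: "a \<in> PL" "b \<in> PL" "c \<in> PL" and abc_sub: "subline_triple a b c"
  shows "subline_triple (inv_pt a) (inv_pt b) (inv_pt c)"
proof (rule subline_triple_transfer[where \<mu> = inverse, OF _ _ _ abc abc_sub])
  have T0: "\<tau> \<noteq> 0" if "\<tau> \<in> T" for \<tau> using T_D(2)[OF that] by auto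
  show "bij_betw inverse T T"
    by (rule bij_betw_byWitness[where f' = inverse]) (auto simp: T_def power_inverse)
  have "inv_pt x \<in> PL" if "x \<in> PL" for x
    using that by (cases x) (auto simp: inv_pt_def F_inverse)
  moreover have "inv_pt (inv_pt x) = x" for x
    by (cases x) (auto simp: inv_pt_def)
  ultimately show "bij_betw inv_pt PL PL"
    by (intro bij_betw_byWitness[where f' = inv_pt]) auto
  \<comment> \<open>The factor does not depend on \<open>x\<close>, so it cancels when powers at two
    points are compared.\<close>
  have "phi (inverse \<tau>) (inv_pt x) = phi \<tau> x * (\<tau> ^ Q / \<tau>)" if "\<tau> \<in> T" "x \<in> PL" for \<tau> x
  proof (cases x)
    case None
    then show ?thesis using T0[OF that(1)] by (simp add: inv_pt_def power_inverse field_simps)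
  next
    case (Some y)
    then have "y \<noteq> \<tau>" "y \<noteq> \<tau> ^ Q" using T_not_F that by auto
    then show ?thesis using Some T0[OF that(1)]
      by (auto simp: inv_pt_def power_inverse divide_simps) (simp_all add: algebra_simps)
  qed
  then show "rel (inverse \<tau>) (inv_pt x) (inv_pt y) \<longleftrightarrow> rel \<tau> x y"
    if "\<tau> \<in> T" "x \<in> PL" "y \<in> PL" for \<tau> x y
    using that T0[OF that(1)] by (simp add: rel_def power_mult_distrib power_divide del: power_Suc)
qed

lemma subline_triple_distinct:
  assumes "a \<in> PL" "b \<in> PL" "c \<in> PL" "distinct [a, b, c]"
  shows "subline_triple a b c"
proof -
  \<comment> \<open>Scaling by \<open>z - y\<close> and then translating by \<open>y\<close> takes
    0, 1 to \<open>y\<close>, \<open>z\<close> and fixes infinity.\<close>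
  have N: "subline_triple None (Some y) (Some z)" if yz: "y \<in> F" "z \<in> F" "y \<noteq> z" for y z
    using subline_triple_translate[OF yz(1) _ _ _ subline_triple_scale[OF _ _ _ _ _ subline_triple_standard, of "z - y"]] yz
    by (simp add: F_closed)
  have S: "subline_triple (Some x) (Some y) (Some z)"
    if x: "x \<in> F" "y \<in> F" "z \<in> F" and d: "x \<noteq> y" "x \<noteq> z" "y \<noteq> z" for x y z
  proof -
    \<comment> \<open>Inversion takes this triple to 0, \<open>y - x\<close>, \<open>z - x\<close>;
      translation by \<open>x\<close> finishes.\<close>
    have "subline_triple None (Some (inverse (y - x))) (Some (inverse (z - x)))"
      using x d by (intro N) (auto simp: F_inverse F_closed)
    from subline_triple_translate[OF x(1) _ _ _ subline_triple_invert[OF _ _ _ this]] show ?thesis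
      using x d by (simp add: inv_pt_def F_inverse F_closed)
  qed
  have "subline_triple b a c" if "a \<noteq> None" "b = None"
    using assms N that by (cases a; cases c) auto
  moreover have "subline_triple c a b" if "a \<noteq> None" "b \<noteq> None" "c = None"
    using assms N that by (cases a; cases b) auto
  moreover have "subline_triple a b c" if "a = None"
    using assms N that by (cases b; cases c) auto
  moreover have "subline_triple a b c" if "a \<noteq> None" "b \<noteq> None" "c \<noteq> None"
    using assms S that by (cases a; cases b; cases c) auto
  ultimately show ?thesis
    using subline_triple_swap by blast
qed

section \<open>The Steiner system and its resolution\<close>

text \<open>Both parameters put \<open>a\<close>, \<open>b\<close>, \<open>c\<close> in one block,
  and that block is independent of the parameter by \<open>subline_triple\<close>.\<close>

lemma blocks_eq:
  assumes "\<sigma> \<in> T" "\<tau> \<in> T" "B \<in> cls \<sigma>" "D \<in> cls \<tau>"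
    and "a \<in> B \<inter> D" "b \<in> B \<inter> D" "c \<in> B \<inter> D" "distinct [a, b, c]"
  shows "B = D"
proof -
  have B: "B = {x\<in>PL. rel \<sigma> a x}" and D: "D = {x\<in>PL. rel \<tau> a x}"
    using assms cls_D by auto
  then have "subline_triple a b c"
    using assms by (intro subline_triple_distinct) auto
  moreover have "rel \<sigma> a b \<and> rel \<sigma> a c" "rel \<tau> a b \<and> rel \<tau> a c"
    using assms B D by auto
  ultimately show ?thesis
    using assms(1,2) B D unfolding subline_triple_def by metis
qed

text \<open>Up to conjugation \<open>(q ^ 2 - q) / 2\<close> parameters belong to each block, and
  \<open>m\<close> is the number of base codes left for each of them.\<close>

lemma TOC_of_base:
  assumes base: "tiling hamming_dist (Hq r (q + 1) 3) ((q + 1) * (r - 1)) P"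
    and card: "2 * card P = (q ^ 2 - q) * m" and r: "1 < r"
  shows "\<exists>P. is_TOC r (Q + 1) 5 3 P"
proof -
  \<comment> \<open>One parameter is kept from each conjugate pair, since both give the same
    class.\<close>
  obtain H where H: "H \<subseteq> T" "\<forall>\<tau>\<in>T. \<tau> \<in> H \<longleftrightarrow> \<tau> ^ Q \<notin> H"
    using ex_half_set[of T "\<lambda>\<tau>. \<tau> ^ Q"] T_conj T_D by metis
  have half: "2 * card {\<tau>\<in>H. rel \<tau> a b \<and> rel \<tau> a c} = q ^ 2 - q"
    if "a \<in> PL" "b \<in> PL" "c \<in> PL" "distinct [a, b, c]" for a b c
  proof -
    let ?S = "{\<tau>\<in>T. rel \<tau> a b \<and> rel \<tau> a c}"
    have "card ?S = 2 * card (?S \<inter> H)"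
    proof (rule card_half_set[where s = "\<lambda>\<tau>. \<tau> ^ Q"])
      show "\<forall>\<tau>\<in>?S. \<tau> \<in> H \<longleftrightarrow> \<tau> ^ Q \<notin> H" using H by blast
      show "finite ?S" using finite_T by simp
    qed (simp_all add: T_conj T_D rel_conj)
    moreover have "?S \<inter> H = {\<tau>\<in>H. rel \<tau> a b \<and> rel \<tau> a c}" using H by auto
    ultimately show ?thesis using subline_triple_distinct[OF that] by (simp add: subline_triple_def)
  qed
  have qq: "0 < q ^ 2 - q"
    using q_gt_1 by (simp add: power2_eq_square)
  have three: "\<exists>a b c. {a, b, c} \<subseteq> A \<and> distinct [a, b, c]" if A: "3 \<le> card A" for A :: "'a option set"
  proof -
    obtain A' where "A' \<subseteq> A" "card A' = 3" using obtain_subset_with_card_n[OF A] by metis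
    then show ?thesis by (auto simp: card_3_iff)
  qed
  have "\<exists>P. tiling fdist (fwords r PL) (card PL * (r - 1)) P"
  proof (rule tiling_of_resolution[where I = H and cls = cls and k = "q + 1" and l = "(q ^ 2 - q) div 2"])
    show "finite PL" by (rule finite_PL)
    show "finite H" using H finite_T finite_subset by blast
    show "partition_on PL (cls \<tau>)" for \<tau> by (rule partition_cls)
    show "card B = q + 1" if "\<tau> \<in> H" "B \<in> cls \<tau>" for \<tau> B
      using that H card_block by (auto simp: cls_def)
    show "B = D" if BD: "\<sigma> \<in> H" "\<tau> \<in> H" "B \<in> cls \<sigma>" "D \<in> cls \<tau>" "3 \<le> card (B \<inter> D)" for \<sigma> \<tau> B D
    proof -
      obtain a b c where "{a, b, c} \<subseteq> B \<inter> D" "distinct [a, b, c]"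
        using three[OF BD(5)] by blast
      then show ?thesis
        using BD H by (intro blocks_eq[of \<sigma> \<tau> B D a b c]) auto
    qed
    show "\<exists>\<tau>\<in>H. \<exists>B\<in>cls \<tau>. A \<subseteq> B" if A: "A \<subseteq> PL" "card A = 3" for A
    proof -
      obtain a b c where abc: "A = {a, b, c}" "distinct [a, b, c]"
        using A(2) by (auto simp: card_3_iff)
      then have "card {\<tau>\<in>H. rel \<tau> a b \<and> rel \<tau> a c} \<noteq> 0"
        using half[of a b c] A qq by auto
      then obtain \<tau> where "\<tau> \<in> H" "rel \<tau> a b" "rel \<tau> a c"
        by (metis (no_types, lifting) card.empty empty_Collect_eq)
      then show ?thesis
        using abc A by (intro bexI[of _ \<tau>] bexI[of _ "{y\<in>PL. rel \<tau> a y}"])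
          (auto simp: cls_def rel_def)
    qed
    show "card {\<tau>\<in>H. B \<in> cls \<tau>} = (q ^ 2 - q) div 2" if \<sigma>: "\<sigma> \<in> H" "B \<in> cls \<sigma>" for \<sigma> B
    proof -
      have "card B = q + 1"
        using \<sigma> H card_block by (auto simp: cls_def)
      then obtain a b c where abc: "{a, b, c} \<subseteq> B" "distinct [a, b, c]"
        using three[of B] q_gt_1 by auto
      then have B: "B = {x\<in>PL. rel \<sigma> a x}" using cls_D(1)[OF \<sigma>(2)] by simp
      \<comment> \<open>Three points determine a block, so the classes containing \<open>B\<close>
        are counted by \<open>half\<close>.\<close>
      have "B \<in> cls \<tau> \<longleftrightarrow> rel \<tau> a b \<and> rel \<tau> a c" if \<tau>: "\<tau> \<in> H" for \<tau>
      proof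
        assume "B \<in> cls \<tau>"
        then have "B = {x\<in>PL. rel \<tau> a x}" using cls_D(1) abc by simp
        then show "rel \<tau> a b \<and> rel \<tau> a c" using abc by auto
      next
        assume R: "rel \<tau> a b \<and> rel \<tau> a c"
        let ?D = "{x\<in>PL. rel \<tau> a x}"
        have D: "?D \<in> cls \<tau>" using B abc by (auto simp: cls_def)
        have "B = ?D"
          using R B abc \<sigma> \<tau> H D by (intro blocks_eq[of \<sigma> \<tau> B ?D a b c]) (auto simp: rel_def)
        then show "B \<in> cls \<tau>" using D by simp
      qed
      then have "{\<tau>\<in>H. B \<in> cls \<tau>} = {\<tau>\<in>H. rel \<tau> a b \<and> rel \<tau> a c}" by auto
      moreover have "a \<in> PL" "b \<in> PL" "c \<in> PL" using B abc by auto
      ultimately show ?thesis using half[of a b c] abc by simp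
    qed
    have "even (q ^ 2 - q)" by (simp add: power2_eq_square)
    then obtain j where "q ^ 2 - q = 2 * j" by (rule evenE)
    then show "card P = (q ^ 2 - q) div 2 * m" using card by simp
    show "PL \<noteq> {}" using PL_simps(1) by blast
  qed (use base r in auto)
  then obtain P' where "tiling fdist (fwords r PL) (card PL * (r - 1)) P'" by blast
  then obtain P'' where "tiling hamming_dist (Hq r (Q + 1) 3) ((Q + 1) * (r - 1)) P''"
    using tiling_Hq_of_fwords[of r PL] finite_PL r card_PL by fastforce
  then show ?thesis
    using tiling_imp_TOC by blast
qed

end

section \<open>The cases \<open>q = 7\<close> and \<open>q = 8\<close>\<close>

text \<open>\<open>mod_ring\<close> builds a prime field over an index type of prime size; this type
  gives characteristic 7, and \<open>bool\<close> will give characteristic 2.\<close>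

typedef seven = "{0..<7 :: nat}"
  by (rule exI[of _ 0]) simp

lemma card_seven: "CARD(seven) = 7"
  using type_definition.card[OF type_definition_seven] by simp

instance seven :: prime_card
  by standard (simp add: card_seven)

theorem theorem4p13:
  fixes n :: nat
  assumes "odd n"
  shows "(\<exists>P. is_TOC 4 (7 ^ n + 1) 5 3 P) \<and> (\<exists>P. is_TOC 3 (8 ^ n + 1) 5 3 P)"
proof
  interpret A: subline_geometry "TYPE(seven mod_ring alg_closure)" 7 n "7 ^ n"
    by standard (use assms in \<open>auto simp: card_seven intro!: exI[of _ 1]\<close>)
  obtain P where "tiling hamming_dist (Hq 4 8 3) (8 * 3) P" "card P = 189"
    using base_tiling_8 by blast
  \<comment> \<open>Each of the 21 classes through a block receives 9 codes:
    \<open>2 * 189 = (7 ^ 2 - 7) * 9\<close>.\<close>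
  then show "\<exists>P. is_TOC 4 (7 ^ n + 1) 5 3 P"
    using A.TOC_of_base[of 4 P 9] by simp
next
  \<comment> \<open>The exponent 3 comes from \<open>8 = 2 ^ 3\<close>.\<close>
  interpret B: subline_geometry "TYPE(bool mod_ring alg_closure)" 8 n "8 ^ n"
    by standard (use assms in \<open>auto intro!: exI[of _ 3]\<close>)
  obtain P where "tiling hamming_dist (Hq 3 9 3) (9 * 2) P" "card P = 112"
    using base_tiling_9 by blast
  \<comment> \<open>Each of the 28 classes through a block receives 4 codes:
    \<open>2 * 112 = (8 ^ 2 - 8) * 4\<close>.\<close>
  then show "\<exists>P. is_TOC 3 (8 ^ n + 1) 5 3 P"
    using B.TOC_of_base[of 3 P 4] by simp
qed

end
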